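(* Let $\Omega\subset\mathbb{R}^d$, $d\in\mathbb{N}$, be a bounded domain, let $c\in L^\infty(\Omega)$ with $c\ge 0$, and let $u\in H^1(\Omega)$ be such that the functional $$F(v):=\int_\Omega \nabla u\cdot\nabla v+c\,u\,v\,\mathrm{d}x,\qquad v\in H^1(\Omega),$$ satisfies $F(v)\le 0$ for all $v\in H^1_0(\Omega)$ with $v\ge 0$ in $\Omega$. Define $\mathcal{J}\colon H^1(\Omega)\to\mathbb{R}$ by $$\mathcal{J}(v):=\frac12\int_\Omega|\nabla v|^2+c\,|v|^2\,\mathrm{d}x-F(v).$$ Let $U\in H^1(\Omega)$ and let $$U^*:=\min\Big\{U,\ \sup_{\partial\Omega}U^+\Big\}\in H^1(\Omega),\qquad U^+:=\max\{0,U\}.$$ Then $$\mathcal{J}(U^* )\le\mathcal{J}(U)\qquad\text{and}\qquad U^*-U\in H^1_0(\Omega).$$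
   Context: $H^1(\Omega)$ is the Sobolev space of (real-valued) square integrable functions with square integrable weak gradient; $H^1_0(\Omega)$ is its subspace of functions with vanishing trace on $\partial\Omega$ (the closure of $C_c^\infty(\Omega)$ in $H^1(\Omega)$). Boundary suprema are understood in the Sobolev (trace) sense: $\sup_{\partial\Omega}U^+:=\inf\{\ell\in\mathbb{R}:(U^+-\ell)^+\in H^1_0(\Omega)\}$, with value $+\infty$ if no such $\ell$ exists, in which case $U^*=U$. Here $w^+=\max\{0,w\}$. Inequalities between functions hold almost everywhere in $\Omega$. *)

theory Defs
  imports "HOL-Analysis.Analysis"
begin

text \<open>
  Elements of Lebesgue and Sobolev spaces are represented by functions on the whole space; only
  their values on \<open>\<Omega>\<close>, up to Lebesgue null sets, matter. Euclidean space is an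
  arbitrary type of class \<^class>\<open>euclidean_space\<close> (so the dimension is at least 1).
\<close>

definition L1loc :: "'a::euclidean_space set \<Rightarrow> ('a \<Rightarrow> 'b::euclidean_space) set" where
  "L1loc \<Omega> = {f. \<forall>K. compact K \<and> K \<subseteq> \<Omega> \<longrightarrow> f absolutely_integrable_on K}"

definition L2 :: "'a::euclidean_space set \<Rightarrow> ('a \<Rightarrow> 'b::euclidean_space) set" where
  "L2 \<Omega> = {f \<in> borel_measurable (lebesgue_on \<Omega>).
             integrable (lebesgue_on \<Omega>) (\<lambda>x. (norm (f x))\<^sup>2)}"

definition Linfty :: "'a::euclidean_space set \<Rightarrow> ('a \<Rightarrow> real) set" where
  "Linfty \<Omega> = {f \<in> borel_measurable (lebesgue_on \<Omega>).
                 \<exists>C. AE x in lebesgue_on \<Omega>. \<bar>f x\<bar> \<le> C}"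

primrec Ck :: "nat \<Rightarrow> ('a::euclidean_space \<Rightarrow> real) \<Rightarrow> bool" where
  "Ck 0 f \<longleftrightarrow> continuous_on UNIV f"
| "Ck (Suc k) f \<longleftrightarrow> f differentiable_on UNIV \<and>
     (\<forall>i\<in>Basis. Ck k (\<lambda>x. frechet_derivative f (at x) i))"

text \<open>
  \<open>C\<^sub>c\<^sup>\<infinity>(\<Omega>)\<close>, each function being extended by zero to the whole space.
\<close>
definition Cc_infty :: "'a::euclidean_space set \<Rightarrow> ('a \<Rightarrow> real) set" where
  "Cc_infty \<Omega> = {\<phi>. (\<forall>k. Ck k \<phi>) \<and> compact (closure {x. \<phi> x \<noteq> 0}) \<and>
                       closure {x. \<phi> x \<noteq> 0} \<subseteq> \<Omega>}"

definition has_weak_gradient ::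
    "'a::euclidean_space set \<Rightarrow> ('a \<Rightarrow> real) \<Rightarrow> ('a \<Rightarrow> 'a) \<Rightarrow> bool" where
  "has_weak_gradient \<Omega> u g \<longleftrightarrow> u \<in> L1loc \<Omega> \<and> g \<in> L1loc \<Omega> \<and>
     (\<forall>\<phi>\<in>Cc_infty \<Omega>. \<forall>i\<in>Basis.
        (LINT x|lebesgue_on \<Omega>. u x * frechet_derivative \<phi> (at x) i) =
        - (LINT x|lebesgue_on \<Omega>. (g x \<bullet> i) * \<phi> x))"

text \<open>
  The weak gradient is unique up to null sets; \<open>weak_gradient\<close> picks a representative and is
  meaningful only if a weak gradient exists.
\<close>
definition weak_gradient :: "'a::euclidean_space set \<Rightarrow> ('a \<Rightarrow> real) \<Rightarrow> 'a \<Rightarrow> 'a" where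
  "weak_gradient \<Omega> u = (SOME g. has_weak_gradient \<Omega> u g)"

definition H1 :: "'a::euclidean_space set \<Rightarrow> ('a \<Rightarrow> real) set" where
  "H1 \<Omega> = {u \<in> L2 \<Omega>. \<exists>g \<in> L2 \<Omega>. has_weak_gradient \<Omega> u g}"

definition H1_norm :: "'a::euclidean_space set \<Rightarrow> ('a \<Rightarrow> real) \<Rightarrow> real" where
  "H1_norm \<Omega> u = sqrt ((LINT x|lebesgue_on \<Omega>. (u x)\<^sup>2) +
                          (LINT x|lebesgue_on \<Omega>. (norm (weak_gradient \<Omega> u x))\<^sup>2))"

definition H10 :: "'a::euclidean_space set \<Rightarrow> ('a \<Rightarrow> real) set" where
  "H10 \<Omega> = {v \<in> H1 \<Omega>. \<forall>\<epsilon>>0. \<exists>\<phi>\<in>Cc_infty \<Omega>. H1_norm \<Omega> (\<lambda>x. v x - \<phi> x) < \<epsilon>}"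

definition pos_part :: "('a \<Rightarrow> real) \<Rightarrow> 'a \<Rightarrow> real" where
  "pos_part w = (\<lambda>x. max 0 (w x))"

text \<open>The infimum in the extended reals is \<open>\<infinity>\<close> if no admissible \<open>l\<close> exists.\<close>
definition bdry_sup :: "'a::euclidean_space set \<Rightarrow> ('a \<Rightarrow> real) \<Rightarrow> ereal" where
  "bdry_sup \<Omega> w = Inf {ereal l | l. pos_part (\<lambda>x. w x - l) \<in> H10 \<Omega>}"

text \<open>
  If the boundary supremum is \<open>\<infinity>\<close>, then \<open>U_star \<Omega> U = U\<close>. The value
  \<open>-\<infinity>\<close>, where \<^const>\<open>real_of_ereal\<close> would be a junk value, does not occur for the nonnegative
  function \<open>pos_part U\<close> on a nonempty bounded open set.
\<close>
definition U_star :: "'a::euclidean_space set \<Rightarrow> ('a \<Rightarrow> real) \<Rightarrow> 'a \<Rightarrow> real" where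
  "U_star \<Omega> U = (\<lambda>x. real_of_ereal (min (ereal (U x)) (bdry_sup \<Omega> (pos_part U))))"

definition F_functional ::
    "'a::euclidean_space set \<Rightarrow> ('a \<Rightarrow> real) \<Rightarrow> ('a \<Rightarrow> real) \<Rightarrow> ('a \<Rightarrow> real) \<Rightarrow> real" where
  "F_functional \<Omega> c u v =
     (LINT x|lebesgue_on \<Omega>. weak_gradient \<Omega> u x \<bullet> weak_gradient \<Omega> v x + c x * u x * v x)"

definition J_functional ::
    "'a::euclidean_space set \<Rightarrow> ('a \<Rightarrow> real) \<Rightarrow> ('a \<Rightarrow> real) \<Rightarrow> ('a \<Rightarrow> real) \<Rightarrow> real" where
  "J_functional \<Omega> c u v =
     1/2 * (LINT x|lebesgue_on \<Omega>. (norm (weak_gradient \<Omega> v x))\<^sup>2 + c x * \<bar>v x\<bar>\<^sup>2)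
     - F_functional \<Omega> c u v"

end

theory Submission
  imports Defs
begin

text \<open>
  Write \<open>s\<close> for the boundary supremum of \<open>U\<^sup>+\<close>. If \<open>s = \<infinity>\<close>, nothing is cut off. Otherwise
  \<open>U\<^sup>* = U - v\<close> with \<open>v = (U - s)\<^sup>+\<close>, and everything follows from three facts: \<open>v\<close> belongs to
  \<open>H\<^sup>1\<^sub>0\<close>, the number \<open>s\<close> is not negative, and the weak gradient of \<open>v\<close> is \<open>\<nabla>U\<close> where \<open>U > s\<close> and zero
  elsewhere. Indeed, \<open>v \<ge> 0\<close> gives \<open>F(v) \<le> 0\<close>, so that \<open>- F(U\<^sup>*) = - F(U) + F(v) \<le> - F(U)\<close>, while
  \<open>\<bar>\<nabla>U\<^sup>*\<bar> \<le> \<bar>\<nabla>U\<bar>\<close> and \<open>\<bar>U\<^sup>*\<bar> \<le> \<bar>U\<bar>\<close> almost everywhere, the latter because \<open>s \<ge> 0\<close>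
  (lemma \<open>J_truncation_le\<close>).

  Weak gradients of positive parts (lemma \<open>pos_part_has_weak_gradient\<close>) are found without
  mollification. Let \<open>u\<close> have the weak derivative \<open>g\<close> in the direction \<open>i\<close>. The difference quotients
  of \<open>u\<close> in this direction converge to \<open>g\<close> weakly, when tested with bounded measurable functions of
  compact support (lemma \<open>DERIV_integral_shift_bounded\<close>). Let \<open>\<phi> \<ge> 0\<close> be a test function. As the
  positive part is convex with subgradient \<open>1\<^bsub>{t > 0}\<^esub>\<close>, the difference
  \<open>\<integral> u\<^sup>+(x) \<phi>(x - h i) dx - \<integral> u(x) (1\<^bsub>{u > 0}\<^esub> \<phi>)(x - h i) dx\<close> has a minimum at \<open>h = 0\<close>, so that
  its derivative \<open>- \<integral> u\<^sup>+ \<partial>\<^sub>i\<phi> - \<integral> g 1\<^bsub>{u > 0}\<^esub> \<phi>\<close> vanishes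
  (lemma \<open>pos_part_weak_derivative_nonneg\<close>). The passage from smooth to bounded measurable functions
  rests on the density lemma \<open>test_limit_exists\<close>, which also yields the fundamental lemma of the
  calculus of variations and with it the uniqueness of weak gradients.

  That \<open>v\<close> lies in \<open>H\<^sup>1\<^sub>0\<close> holds because the set of admissible levels \<open>l\<close> is closed under limits
  from above (lemma \<open>excess_in_H10_limit\<close>). A negative level \<open>l\<close> is not admissible, since
  \<open>U\<^sup>+ - l\<close> is bounded below by \<open>-l > 0\<close> and such a function does not have vanishing trace
  (lemma \<open>H10_not_bounded_below\<close>).
\<close>

section \<open>Smooth functions\<close>

lemma Ck_SucI:
  assumes "\<And>x. (f has_derivative D x) (at x)"
    and "\<And>i. i \<in> Basis \<Longrightarrow> Ck k (\<lambda>x. D x i)"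
  shows "Ck (Suc k) f"
proof -
  have "frechet_derivative f (at x) = D x" for x
    using frechet_derivative_at[OF assms(1)] by simp
  then show ?thesis
    using assms by (auto simp: differentiable_on_def differentiable_def intro: has_derivative_at_withinI)
qed

lemma Ck_Suc_has_derivative:
  "Ck (Suc k) f \<Longrightarrow> (f has_derivative frechet_derivative f (at x)) (at x)"
  by (simp add: differentiable_on_def frechet_derivative_works)

lemma Ck_Suc_imp_Ck: "Ck (Suc k) f \<Longrightarrow> Ck k f"
proof (induction k arbitrary: f)
  case 0
  then show ?case using differentiable_imp_continuous_on by auto
next
  case (Suc k)
  have "Ck (Suc k) (\<lambda>x. frechet_derivative f (at x) i)" if "i \<in> Basis" for i
    using Suc.prems that by (metis Ck.simps(2))
  then have "Ck k (\<lambda>x. frechet_derivative f (at x) i)" if "i \<in> Basis" for i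
    using Suc.IH that by blast
  then show ?case
    using Suc.prems by (metis Ck.simps(2))
qed

lemma Ck_const: "Ck k (\<lambda>x. c)"
proof (induction k arbitrary: c)
  case (Suc k)
  show ?case by (rule Ck_SucI[where D="\<lambda>x h. 0"]) (use Suc in auto)
qed auto

lemma Ck_bounded_linear:
  assumes "bounded_linear f" shows "Ck k f"
proof (cases k)
  case 0
  then show ?thesis using assms linear_continuous_on by auto
next
  case (Suc j)
  show ?thesis unfolding Suc
    by (rule Ck_SucI[where D="\<lambda>x. f"])
      (auto simp: bounded_linear_imp_has_derivative assms Ck_const)
qed

lemma Ck_add:
  assumes "Ck k f" "Ck k g" shows "Ck k (\<lambda>x. f x + g x)"
  using assms
proof (induction k arbitrary: f g)
  case 0
  then show ?case by (auto intro: continuous_intros)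
next
  case (Suc k)
  show ?case
  proof (rule Ck_SucI)
    show "((\<lambda>x. f x + g x) has_derivative
        (\<lambda>h. frechet_derivative f (at x) h + frechet_derivative g (at x) h)) (at x)" for x
      by (intro has_derivative_add Ck_Suc_has_derivative[OF Suc.prems(1)] Ck_Suc_has_derivative[OF Suc.prems(2)])
    show "Ck k (\<lambda>x. frechet_derivative f (at x) i + frechet_derivative g (at x) i)" if "i \<in> Basis" for i
      using Suc that by auto
  qed
qed

lemma Ck_mult:
  assumes "Ck k f" "Ck k g" shows "Ck k (\<lambda>x. f x * g x)"
  using assms
proof (induction k arbitrary: f g)
  case 0
  then show ?case by (auto intro: continuous_intros)
next
  case (Suc k)
  show ?case
  proof (rule Ck_SucI)
    show "((\<lambda>x. f x * g x) has_derivative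
        (\<lambda>h. f x * frechet_derivative g (at x) h + frechet_derivative f (at x) h * g x)) (at x)" for x
      by (intro has_derivative_mult Ck_Suc_has_derivative[OF Suc.prems(1)] Ck_Suc_has_derivative[OF Suc.prems(2)])
    show "Ck k (\<lambda>x. f x * frechet_derivative g (at x) i + frechet_derivative f (at x) i * g x)"
      if "i \<in> Basis" for i
    proof -
      have "Ck k (\<lambda>x. frechet_derivative f (at x) i)" "Ck k (\<lambda>x. frechet_derivative g (at x) i)"
        using Suc.prems that by auto
      then show ?thesis
        by (intro Ck_add[OF Suc.IH[OF Ck_Suc_imp_Ck[OF Suc.prems(1)]] Suc.IH[OF _ Ck_Suc_imp_Ck[OF Suc.prems(2)]]])
    qed
  qed
qed

lemma Ck_sum: "finite A \<Longrightarrow> (\<And>a. a \<in> A \<Longrightarrow> Ck k (f a)) \<Longrightarrow> Ck k (\<lambda>x. \<Sum>a\<in>A. f a x)"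
  by (induction A rule: finite_induct) (auto intro: Ck_const Ck_add)

lemma Ck_polynomial: "real_polynomial_function p \<Longrightarrow> Ck k p"
  by (induction rule: real_polynomial_function.induct)
    (auto intro: Ck_const Ck_add Ck_mult Ck_bounded_linear)

lemma Ck_shift:
  assumes "Ck k f" shows "Ck k (\<lambda>x. f (x - a))"
  using assms
proof (induction k arbitrary: f)
  case 0
  then have "continuous_on UNIV f" by simp
  then have "continuous_on UNIV (f \<circ> (\<lambda>x. x - a))"
    by (intro continuous_on_compose continuous_intros) (auto elim: continuous_on_subset)
  then show ?case by (simp add: o_def)
next
  case (Suc k)
  show ?case
  proof (rule Ck_SucI)
    show "((\<lambda>x. f (x - a)) has_derivative frechet_derivative f (at (x - a))) (at x)" for x
    proof -
      have "((\<lambda>x. x - a) has_derivative (\<lambda>h. h)) (at x)"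
        by (auto intro!: derivative_eq_intros)
      from has_derivative_compose[OF this Ck_Suc_has_derivative[OF Suc.prems]]
      show ?thesis .
    qed
    show "Ck k (\<lambda>x. frechet_derivative f (at (x - a)) i)" if "i \<in> Basis" for i
      using Suc.IH[of "\<lambda>x. frechet_derivative f (at x) i"] Suc.prems that by auto
  qed
qed

text \<open>
  The functions \<open>t \<mapsto> t\<^sup>-\<^sup>n exp (-1/t)\<close>, extended by zero to \<open>t \<le> 0\<close>. The derivative of each
  is a linear combination of two others, so that smoothness follows for all \<open>n\<close> at once.
\<close>
definition flat_exp :: "nat \<Rightarrow> real \<Rightarrow> real" where
  "flat_exp n t = (if 0 < t then (1/t) ^ n * exp (- (1/t)) else 0)"

lemma flat_exp_limit_0: "(flat_exp n \<longlongrightarrow> 0) (at_right 0)"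
proof -
  have "((\<lambda>s::real. s ^ n / exp s) \<longlongrightarrow> 0) at_top"
    by (rule tendsto_power_div_exp_0)
  then have "((\<lambda>t::real. (inverse t) ^ n / exp (inverse t)) \<longlongrightarrow> 0) (at_right 0)"
    using filterlim_compose filterlim_inverse_at_top_right by blast
  then show ?thesis
    by (rule Lim_transform_eventually)
      (auto simp: eventually_at_filter flat_exp_def exp_minus divide_simps)
qed

lemma flat_exp_has_derivative:
  "(flat_exp n has_real_derivative (flat_exp (n+2) t - real n * flat_exp (n+1) t)) (at t)"
proof -
  consider "t < 0" | "t = 0" | "t > 0" by linarith
  then show ?thesis
  proof cases
    case 1
    have "((\<lambda>_. 0) has_real_derivative 0) (at t)" by simp
    then have "(flat_exp n has_real_derivative 0) (at t)"
      by (rule has_field_derivative_transform_within_open[where S="{..<0}"])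
        (use 1 in \<open>auto simp: flat_exp_def\<close>)
    then show ?thesis using 1 by (simp add: flat_exp_def)
  next
    case 2
    have r: "((\<lambda>h. flat_exp n h / h) \<longlongrightarrow> 0) (at_right 0)"
      by (rule Lim_transform_eventually[OF flat_exp_limit_0[of "Suc n"]])
        (auto simp: eventually_at_filter flat_exp_def)
    have l: "((\<lambda>h. flat_exp n h / h) \<longlongrightarrow> 0) (at_left 0)"
      by (rule Lim_transform_eventually[OF tendsto_const])
        (auto simp: eventually_at_filter flat_exp_def)
    have "((\<lambda>h. flat_exp n h / h) \<longlongrightarrow> 0) (at 0)"
      using l r by (simp add: filterlim_at_split)
    then show ?thesis using 2
      by (simp add: DERIV_def) (simp add: flat_exp_def)
  next
    case 3
    define s where "s = 1/t"
    have "((\<lambda>t. (1/t) ^ n * exp (- (1/t))) has_real_derivative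
        (real n * s ^ (n - 1) * (- (s\<^sup>2)) * exp (- s) + s ^ n * (exp (- s) * s\<^sup>2))) (at t)"
      using 3 by (auto intro!: derivative_eq_intros simp: s_def power2_eq_square)
    moreover have "real n * s ^ (n - 1) * (- (s\<^sup>2)) * exp (- s) + s ^ n * (exp (- s) * s\<^sup>2)
        = flat_exp (n+2) t - real n * flat_exp (n+1) t"
      using 3 by (cases n) (simp_all add: flat_exp_def power2_eq_square algebra_simps flip: s_def)
    ultimately have "((\<lambda>t. (1/t) ^ n * exp (- (1/t))) has_real_derivative
        (flat_exp (n+2) t - real n * flat_exp (n+1) t)) (at t)"
      by simp
    then show ?thesis
      by (rule has_field_derivative_transform_within_open[where S="{0<..}"])
        (use 3 in \<open>auto simp: flat_exp_def\<close>)
  qed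
qed

lemma Ck_flat_exp_compose:
  assumes "\<And>k. Ck k \<psi>" shows "Ck k (\<lambda>x. flat_exp n (\<psi> x))"
proof (induction k arbitrary: n)
  case 0
  have "continuous_on UNIV (flat_exp n)"
    by (meson DERIV_isCont continuous_at_imp_continuous_on flat_exp_has_derivative)
  then have "continuous_on UNIV (flat_exp n \<circ> \<psi>)"
    using assms[of 0] by (intro continuous_on_compose) (auto elim: continuous_on_subset)
  then show ?case by (simp add: o_def)
next
  case (Suc k)
  define q where "q t = flat_exp (n+2) t - real n * flat_exp (n+1) t" for t
  show ?case
  proof (rule Ck_SucI)
    show "((\<lambda>x. flat_exp n (\<psi> x)) has_derivative (\<lambda>h. q (\<psi> x) * frechet_derivative \<psi> (at x) h)) (at x)" for x
      using has_derivative_compose[OF Ck_Suc_has_derivative[OF assms, where x=x]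
          flat_exp_has_derivative[unfolded has_field_derivative_def]]
      by (simp add: q_def)
    show "Ck k (\<lambda>x. q (\<psi> x) * frechet_derivative \<psi> (at x) i)" if "i \<in> Basis" for i
    proof (rule Ck_mult)
      have "Ck k (\<lambda>x. flat_exp (n+2) (\<psi> x) + (- real n) * flat_exp (n+1) (\<psi> x))"
        by (intro Ck_add Ck_mult Ck_const Suc)
      then show "Ck k (\<lambda>x. q (\<psi> x))" by (simp add: q_def)
      show "Ck k (\<lambda>x. frechet_derivative \<psi> (at x) i)"
        using assms[of "Suc k"] that by simp
    qed
  qed
qed

section \<open>Test functions\<close>

lemma Cc_inftyI:
  assumes "\<And>k. Ck k \<phi>" "compact K" "K \<subseteq> \<Omega>" "\<And>x. x \<notin> K \<Longrightarrow> \<phi> x = 0"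
  shows "\<phi> \<in> Cc_infty \<Omega>"
proof -
  have "closure {x. \<phi> x \<noteq> 0} \<subseteq> K"
    using assms by (intro closure_minimal) (auto simp: compact_imp_closed)
  moreover from this have "compact (closure {x. \<phi> x \<noteq> 0})"
    using assms(2) closed_closure compact_Int_closed by (metis inf.absorb2)
  ultimately show ?thesis using assms by (auto simp: Cc_infty_def)
qed

lemma Cc_inftyE:
  assumes "\<phi> \<in> Cc_infty \<Omega>"
  obtains K where "compact K" "K \<subseteq> \<Omega>" "\<And>x. x \<notin> K \<Longrightarrow> \<phi> x = 0"
    "\<And>x h. x \<notin> K \<Longrightarrow> frechet_derivative \<phi> (at x) h = 0"
proof
  let ?K = "closure {x. \<phi> x \<noteq> 0}"
  show "compact ?K" "?K \<subseteq> \<Omega>" using assms by (auto simp: Cc_infty_def)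
  show z: "\<phi> x = 0" if "x \<notin> ?K" for x
    using closure_subset[of "{x. \<phi> x \<noteq> 0}"] that by blast
  show "frechet_derivative \<phi> (at x) h = 0" if "x \<notin> ?K" for x h
  proof -
    have "(\<phi> has_derivative (\<lambda>h. 0)) (at x)"
    proof (rule has_derivative_transform_within_open)
      show "((\<lambda>x. 0) has_derivative (\<lambda>h. 0)) (at x)" by (rule has_derivative_const)
      show "open (- ?K)" by (rule open_Compl) (rule closed_closure)
      show "x \<in> - ?K" using that by simp
      show "0 = \<phi> y" if "y \<in> - ?K" for y using z[of y] that by simp
    qed
    then show ?thesis using frechet_derivative_at by metis
  qed
qed

lemma Cc_infty_smooth: "\<phi> \<in> Cc_infty \<Omega> \<Longrightarrow> Ck k \<phi>"
  by (simp add: Cc_infty_def)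

lemma Cc_infty_mult_smooth:
  assumes "\<phi> \<in> Cc_infty \<Omega>" "\<And>k. Ck k f"
  shows "(\<lambda>x. \<phi> x * f x) \<in> Cc_infty \<Omega>"
proof -
  obtain K where "compact K" "K \<subseteq> \<Omega>" "\<And>x. x \<notin> K \<Longrightarrow> \<phi> x = 0"
    using Cc_inftyE[OF assms(1)] by metis
  then show ?thesis
    using Ck_mult[OF Cc_infty_smooth[OF assms(1)] assms(2)] by (intro Cc_inftyI[of _ K]) simp_all
qed

lemma Cc_infty_cmult: "\<phi> \<in> Cc_infty \<Omega> \<Longrightarrow> (\<lambda>x. a * \<phi> x) \<in> Cc_infty \<Omega>"
  using Cc_infty_mult_smooth[OF _ Ck_const, of \<phi> \<Omega> a] by (simp add: mult.commute)

lemma Cc_infty_add: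
  assumes "\<phi> \<in> Cc_infty \<Omega>" "\<psi> \<in> Cc_infty \<Omega>"
  shows "(\<lambda>x. \<phi> x + \<psi> x) \<in> Cc_infty \<Omega>"
proof -
  obtain K where "compact K" "K \<subseteq> \<Omega>" "\<And>x. x \<notin> K \<Longrightarrow> \<phi> x = 0"
    using Cc_inftyE[OF assms(1)] by metis
  moreover obtain L where "compact L" "L \<subseteq> \<Omega>" "\<And>x. x \<notin> L \<Longrightarrow> \<psi> x = 0"
    using Cc_inftyE[OF assms(2)] by metis
  ultimately show ?thesis
    using Ck_add[OF Cc_infty_smooth[OF assms(1)] Cc_infty_smooth[OF assms(2)]]
    by (intro Cc_inftyI[of _ "K \<union> L"]) auto
qed

lemma Cc_infty_continuous: "\<phi> \<in> Cc_infty \<Omega> \<Longrightarrow> continuous_on UNIV \<phi>"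
  using Cc_infty_smooth[of \<phi> \<Omega> 0] by simp

lemma Cc_infty_continuous_deriv:
  "\<phi> \<in> Cc_infty \<Omega> \<Longrightarrow> i \<in> Basis \<Longrightarrow> continuous_on UNIV (\<lambda>x. frechet_derivative \<phi> (at x) i)"
  using Cc_infty_smooth[of \<phi> \<Omega> 1] by simp

lemma Cc_infty_has_derivative:
  "\<phi> \<in> Cc_infty \<Omega> \<Longrightarrow> (\<phi> has_derivative frechet_derivative \<phi> (at x)) (at x)"
  using Ck_Suc_has_derivative[OF Cc_infty_smooth[of \<phi> \<Omega> 1, unfolded One_nat_def]] .

text \<open>A finite sum of bumps \<open>exp (-1/(r\<^sup>2 - |x - a|\<^sup>2))\<close> covering \<open>K\<close>.\<close>
lemma cutoff_exists:
  fixes K \<Omega> :: "'a::euclidean_space set"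
  assumes "compact K" "open \<Omega>" "K \<subseteq> \<Omega>"
  obtains \<eta> where "\<eta> \<in> Cc_infty \<Omega>" "\<And>x. 0 \<le> \<eta> x" "\<And>x. x \<in> K \<Longrightarrow> 0 < \<eta> x"
proof -
  define b :: "'a \<Rightarrow> real \<Rightarrow> 'a \<Rightarrow> real" where
    "b a r x = flat_exp 0 (r\<^sup>2 - (norm (x - a))\<^sup>2)" for a r x
  have b_nonneg: "0 \<le> b a r x" for a r x
    by (simp add: b_def flat_exp_def)
  have b_pos: "0 < b a r x \<longleftrightarrow> norm (x - a) < r" if "r > 0" for a r x
  proof -
    have "norm (x - a) < r \<longleftrightarrow> (norm (x - a))\<^sup>2 < r\<^sup>2"
      using power_mono_iff[of r "norm (x - a)" 2] that by (simp flip: not_le)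
    then show ?thesis by (auto simp: b_def flat_exp_def)
  qed
  have b_smooth: "Ck k (b a r)" for k a r
  proof -
    have lin: "Ck j (\<lambda>x. (x \<bullet> i) + (- (a \<bullet> i)))" for j i
      by (intro Ck_add Ck_const Ck_bounded_linear bounded_linear_inner_left)
    have "Ck j (\<lambda>x. r\<^sup>2 + (-1) * (\<Sum>i\<in>Basis. ((x \<bullet> i) + (- (a \<bullet> i))) * ((x \<bullet> i) + (- (a \<bullet> i)))))" for j
      by (rule Ck_add[OF Ck_const Ck_mult[OF Ck_const Ck_sum[OF finite_Basis Ck_mult[OF lin lin]]]])
    moreover have "r\<^sup>2 + (-1) * (\<Sum>i\<in>Basis. ((x \<bullet> i) + (- (a \<bullet> i))) * ((x \<bullet> i) + (- (a \<bullet> i))))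
        = r\<^sup>2 - (norm (x - a))\<^sup>2" for x
      unfolding power2_norm_eq_inner euclidean_inner[of "x - a" "x - a"] by (simp add: inner_diff_left)
    ultimately have "Ck j (\<lambda>x. r\<^sup>2 - (norm (x - a))\<^sup>2)" for j
      by (simp only:)
    then show ?thesis unfolding b_def by (rule Ck_flat_exp_compose)
  qed
  have "\<forall>a\<in>K. \<exists>r>0. cball a r \<subseteq> \<Omega>"
    using assms open_contains_cball by blast
  then obtain r where r: "\<And>a. a \<in> K \<Longrightarrow> r a > 0 \<and> cball a (r a) \<subseteq> \<Omega>"
    by metis
  have "K \<subseteq> (\<Union>a\<in>K. ball a (r a))" using r by force
  then obtain A where A: "A \<subseteq> K" "finite A" "K \<subseteq> (\<Union>a\<in>A. ball a (r a))"
    using compactE_image[OF assms(1), of K "\<lambda>a. ball a (r a)"] by (metis open_ball)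
  define \<eta> where "\<eta> x = (\<Sum>a\<in>A. b a (r a) x)" for x
  show ?thesis
  proof
    show "\<eta> \<in> Cc_infty \<Omega>"
    proof (rule Cc_inftyI[of _ "\<Union>a\<in>A. cball a (r a)"])
      show "Ck k \<eta>" for k unfolding \<eta>_def by (intro Ck_sum A b_smooth)
      show "compact (\<Union>a\<in>A. cball a (r a))" using A by auto
      show "(\<Union>a\<in>A. cball a (r a)) \<subseteq> \<Omega>" using A r by blast
      show "\<eta> x = 0" if "x \<notin> (\<Union>a\<in>A. cball a (r a))" for x
        unfolding \<eta>_def
      proof (rule sum.neutral, rule)
        fix a assume a: "a \<in> A"
        then have "\<not> norm (x - a) < r a" using that by (auto simp: dist_norm norm_minus_commute)
        then have "\<not> 0 < b a (r a) x" using b_pos a A r by blast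
        then show "b a (r a) x = 0" using b_nonneg[of a "r a" x] by linarith
      qed
    qed
    show "0 \<le> \<eta> x" for x by (simp add: \<eta>_def sum_nonneg b_nonneg)
    show "0 < \<eta> x" if xK: "x \<in> K" for x
    proof -
      obtain a where a: "a \<in> A" "x \<in> ball a (r a)" using A xK by blast
      then have "r a > 0" "norm (x - a) < r a"
        using A r by (auto simp: dist_norm norm_minus_commute)
      then have "0 < b a (r a) x" using b_pos by blast
      then show ?thesis unfolding \<eta>_def
        by (rule sum_pos2[OF A(2) a(1)]) (rule b_nonneg)
    qed
  qed
qed

section \<open>Translations and local integrability\<close>

lemma continuous_imp_lebesgue_measurable:
  fixes f :: "'a::euclidean_space \<Rightarrow> 'b::euclidean_space"
  shows "continuous_on UNIV f \<Longrightarrow> f \<in> borel_measurable lebesgue"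
  by (simp add: borel_measurable_continuous_onI measurable_completion)

lemma
  fixes a :: "'a::euclidean_space"
  shows measurable_lebesgue_shift: "(\<lambda>x. x - a) \<in> lebesgue \<rightarrow>\<^sub>M lebesgue"
    and distr_lebesgue_shift: "distr lebesgue lebesgue (\<lambda>x. x - a) = lebesgue"
proof -
  have eq: "(\<lambda>x. - a + (\<Sum>j\<in>Basis. (1 * (x \<bullet> j)) *\<^sub>R j)) = (\<lambda>x. x - a)"
    by (simp add: euclidean_representation)
  show "(\<lambda>x. x - a) \<in> lebesgue \<rightarrow>\<^sub>M lebesgue"
    using lebesgue_affine_measurable[of "\<lambda>_. 1" "- a"] unfolding eq by simp
  show "distr lebesgue lebesgue (\<lambda>x. x - a) = lebesgue"
    using lebesgue_affine_euclidean[of "\<lambda>_. 1" "- a"] unfolding eq by (simp add: density_1)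
qed

lemma integral_lebesgue_shift:
  fixes f :: "'a::euclidean_space \<Rightarrow> real"
  assumes "f \<in> borel_measurable lebesgue"
  shows "(LINT x|lebesgue. f (x - a)) = (LINT x|lebesgue. f x)"
  using integral_distr[OF measurable_lebesgue_shift[of a] assms] by (simp add: distr_lebesgue_shift)

lemma integrable_lebesgue_shift:
  fixes f :: "'a::euclidean_space \<Rightarrow> real"
  assumes "integrable lebesgue f"
  shows "integrable lebesgue (\<lambda>x. f (x - a))"
  using assms integrable_distr_eq[OF measurable_lebesgue_shift[of a], of f]
  by (simp add: distr_lebesgue_shift)

lemma measurable_compose_shift:
  fixes f :: "'a::euclidean_space \<Rightarrow> real"
  shows "f \<in> borel_measurable lebesgue \<Longrightarrow> (\<lambda>x. f (x - a)) \<in> borel_measurable lebesgue"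
  using measurable_compose[OF measurable_lebesgue_shift] by blast

lemma L1loc_mult_integrable:
  fixes u \<psi> :: "'a::euclidean_space \<Rightarrow> real"
  assumes "u \<in> L1loc \<Omega>" "\<psi> \<in> borel_measurable lebesgue" "\<And>x. \<bar>\<psi> x\<bar> \<le> M"
    and "compact K" "\<And>x. x \<notin> K \<Longrightarrow> \<psi> x = 0" "K \<subseteq> \<Omega>"
  shows "integrable lebesgue (\<lambda>x. u x * \<psi> x)"
proof -
  have i: "integrable lebesgue (\<lambda>x. indicator K x * u x)"
    using assms(1,4,6) by (auto simp: L1loc_def set_integrable_def)
  have eq: "(\<lambda>x. u x * \<psi> x) = (\<lambda>x. (indicator K x * u x) * \<psi> x)"
    by (rule ext) (use assms(5) in \<open>auto simp: indicator_def\<close>)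
  show ?thesis unfolding eq
  proof (rule Bochner_Integration.integrable_bound)
    show "integrable lebesgue (\<lambda>x. M * (indicator K x * u x))"
      using i by simp
    show "(\<lambda>x. indicator K x * u x * \<psi> x) \<in> borel_measurable lebesgue"
      using borel_measurable_integrable[OF i] assms(2) by (rule borel_measurable_times)
    have "\<bar>indicator K x * u x * \<psi> x\<bar> \<le> \<bar>M * (indicator K x * u x)\<bar>" for x
    proof -
      have "\<bar>\<psi> x\<bar> \<le> \<bar>M\<bar>" using assms(3)[of x] by linarith
      then show ?thesis
        using mult_right_mono[of "\<bar>\<psi> x\<bar>" "\<bar>M\<bar>" "\<bar>indicator K x * u x\<bar>"]
        by (simp add: abs_mult mult.commute)
    qed
    then show "AE x in lebesgue. norm (indicator K x * u x * \<psi> x) \<le> norm (M * (indicator K x * u x))"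
      by simp
  qed
qed

lemma const_L1loc: "(\<lambda>x. c::real) \<in> L1loc \<Omega>"
  by (auto simp: L1loc_def absolutely_integrable_on_const lmeasurable_compact)

lemma continuous_compact_support_bounded:
  fixes f :: "'a::euclidean_space \<Rightarrow> real"
  assumes "continuous_on UNIV f" "compact K" "\<And>x. x \<notin> K \<Longrightarrow> f x = 0"
  obtains C where "0 < C" "\<And>x. \<bar>f x\<bar> \<le> C"
proof -
  have "bounded (f ` K)"
    using assms by (meson compact_continuous_image compact_imp_bounded continuous_on_subset subset_UNIV)
  then obtain C where "0 < C" "\<And>x. x \<in> K \<Longrightarrow> \<bar>f x\<bar> \<le> C"
    unfolding bounded_pos by auto
  then show ?thesis using assms(3) that[of C] by (metis abs_zero less_le)
qed

lemma continuous_pos_lower_bound: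
  fixes f :: "'a::topological_space \<Rightarrow> real"
  assumes "compact K" "continuous_on K f" "\<And>x. x \<in> K \<Longrightarrow> 0 < f x"
  shows "\<exists>m>0. \<forall>x\<in>K. m \<le> f x"
proof (cases "K = {}")
  case True
  then show ?thesis using zero_less_one by blast
next
  case False
  then obtain y where "y \<in> K" "\<forall>x\<in>K. f y \<le> f x"
    using continuous_attains_inf[OF assms(1) False assms(2)] by blast
  then show ?thesis using assms(3) by blast
qed

text \<open>Differentiation of \<open>\<integral> u(x) f(x - t e) dx\<close> in \<open>t\<close> under the integral sign.\<close>
lemma DERIV_integral_shift:
  fixes u f f' :: "'a::euclidean_space \<Rightarrow> real"
  assumes u: "u \<in> L1loc UNIV"
    and cont: "continuous_on UNIV f" "continuous_on UNIV f'"
    and K: "compact K" "\<And>x. x \<notin> K \<Longrightarrow> f x = 0" "\<And>x. x \<notin> K \<Longrightarrow> f' x = 0"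
    and deriv: "\<And>x. ((\<lambda>t. f (x + t *\<^sub>R e)) has_real_derivative f' x) (at 0)"
  shows "((\<lambda>t. LINT x|lebesgue. u x * f (x - t *\<^sub>R e)) has_real_derivative
      - (LINT x|lebesgue. u x * f' (x - t *\<^sub>R e))) (at t)"
proof -
  obtain C where C: "0 < C" "\<And>x. \<bar>f' x\<bar> \<le> C"
    using continuous_compact_support_bounded[OF cont(2) K(1,3)] by blast
  obtain C0 where C0: "0 < C0" "\<And>x. \<bar>f x\<bar> \<le> C0"
    using continuous_compact_support_bounded[OF cont(1) K(1,2)] by blast
  have dr: "((\<lambda>r. f (x - r *\<^sub>R e)) has_real_derivative - f' (x - r *\<^sub>R e)) (at r)" for x r
  proof -
    have "((\<lambda>r'. r - r') has_real_derivative -1) (at r)"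
      by (auto intro!: derivative_eq_intros)
    moreover have "((\<lambda>t. f ((x - r *\<^sub>R e) + t *\<^sub>R e)) has_real_derivative f' (x - r *\<^sub>R e)) (at (r - r))"
      using deriv[of "x - r *\<^sub>R e"] by simp
    ultimately have "((\<lambda>r'. f ((x - r *\<^sub>R e) + (r - r') *\<^sub>R e)) has_real_derivative f' (x - r *\<^sub>R e) * -1) (at r)"
      using DERIV_chain2[where g="\<lambda>r'. r - r'"] by blast
    then show ?thesis by (simp add: algebra_simps)
  qed
  have lip: "\<bar>f (x - r *\<^sub>R e) - f (x - r' *\<^sub>R e)\<bar> \<le> C * \<bar>r - r'\<bar>" for x r r'
  proof -
    have *: "\<bar>f (x - r *\<^sub>R e) - f (x - r' *\<^sub>R e)\<bar> \<le> C * \<bar>r - r'\<bar>" if rr: "r < r'" for r r'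
    proof -
      obtain z where "f (x - r' *\<^sub>R e) - f (x - r *\<^sub>R e) = (r' - r) * (- f' (x - z *\<^sub>R e))"
        using MVT2[OF rr, of "\<lambda>r. f (x - r *\<^sub>R e)" "\<lambda>r. - f' (x - r *\<^sub>R e)"] dr by blast
      then have "\<bar>f (x - r *\<^sub>R e) - f (x - r' *\<^sub>R e)\<bar> = \<bar>f' (x - z *\<^sub>R e)\<bar> * \<bar>r - r'\<bar>"
        by (metis abs_minus_commute abs_minus_cancel abs_mult mult.commute)
      then show ?thesis using C(2) by (simp add: mult_right_mono)
    qed
    show ?thesis
      using *[of r r'] *[of r' r] by (cases r r' rule: linorder_cases) (auto simp: abs_minus_commute)
  qed
  define A where "A t = (LINT x|lebesgue. u x * f (x - t *\<^sub>R e))" for t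
  have shiftc: "continuous_on UNIV (\<lambda>x. g (x - a))" if "continuous_on UNIV g" for g :: "'a \<Rightarrow> real" and a
    by (rule continuous_on_compose2[OF that]) (auto intro: continuous_intros)
  define S where "S R = (\<lambda>(k, r). k + r *\<^sub>R e) ` (K \<times> {-R..R})" for R :: real
  have S: "compact (S R)" for R
    unfolding S_def
    by (intro compact_continuous_image compact_Times K)
      (auto simp: case_prod_beta intro!: continuous_intros)
  have inS: "x \<in> S R" if "x - r *\<^sub>R e \<in> K" "\<bar>r\<bar> \<le> R" for x r R
    unfolding S_def using that by (intro image_eqI[of _ _ "(x - r *\<^sub>R e, r)"]) auto
  have int: "integrable lebesgue (\<lambda>x. u x * f (x - t *\<^sub>R e))" for t
    by (rule L1loc_mult_integrable[OF u _ _ S[of "\<bar>t\<bar>"], where M=C0])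
      (auto intro!: C0 continuous_imp_lebesgue_measurable shiftc cont K intro: inS)
  have meas': "(\<lambda>x. f' (x - t *\<^sub>R e)) \<in> borel_measurable lebesgue"
    by (intro continuous_imp_lebesgue_measurable shiftc cont)
  have int': "integrable lebesgue (\<lambda>x. u x * f' (x - t *\<^sub>R e))"
    by (rule L1loc_mult_integrable[OF u meas' C(2) S[of "\<bar>t\<bar>"]])
      (auto intro!: K intro: inS)
  have "((\<lambda>s. (A (t + s) - A t) / s) \<longlongrightarrow> - (LINT x|lebesgue. u x * f' (x - t *\<^sub>R e))) (at 0)"
    unfolding tendsto_at_iff_sequentially
  proof (intro allI impI)
    fix X :: "nat \<Rightarrow> real"
    assume X: "\<forall>i. X i \<in> UNIV - {0}" "X \<longlonglongrightarrow> 0"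
    then obtain R where R: "\<And>i. \<bar>X i\<bar> \<le> R"
      using convergent_imp_Bseq[of X] by (auto simp: convergent_def Bseq_def)
    let ?T = "S (\<bar>t\<bar> + R)"
    let ?q = "\<lambda>i x. u x * ((f (x - (t + X i) *\<^sub>R e) - f (x - t *\<^sub>R e)) / X i)"
    have "(\<lambda>i. LINT x|lebesgue. ?q i x) \<longlonglongrightarrow> (LINT x|lebesgue. u x * - f' (x - t *\<^sub>R e))"
    proof (rule integral_dominated_convergence[where w="\<lambda>x. C * \<bar>indicator ?T x * u x\<bar>"])
      have "integrable lebesgue (\<lambda>x. indicator ?T x * u x)"
        using u S by (auto simp: L1loc_def set_integrable_def)
      then show "integrable lebesgue (\<lambda>x. C * \<bar>indicator ?T x * u x\<bar>)"
        by simp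
      show "(\<lambda>x. u x * - f' (x - t *\<^sub>R e)) \<in> borel_measurable lebesgue"
        using borel_measurable_integrable[OF int'] by simp
      show "?q i \<in> borel_measurable lebesgue" for i
      proof -
        have "?q i = (\<lambda>x. (u x * f (x - (t + X i) *\<^sub>R e) - u x * f (x - t *\<^sub>R e)) / X i)"
          by (simp add: fun_eq_iff right_diff_distrib)
        then show ?thesis
          using borel_measurable_integrable[OF int] by simp
      qed
      show "AE x in lebesgue. (\<lambda>i. ?q i x) \<longlonglongrightarrow> u x * - f' (x - t *\<^sub>R e)"
      proof (rule AE_I2, rule tendsto_mult_left)
        fix x
        have "((\<lambda>s. (f (x - (t + s) *\<^sub>R e) - f (x - t *\<^sub>R e)) / s) \<longlongrightarrow> - f' (x - t *\<^sub>R e)) (at 0)"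
          using dr[of x t] by (simp add: DERIV_def)
        then show "(\<lambda>i. (f (x - (t + X i) *\<^sub>R e) - f (x - t *\<^sub>R e)) / X i) \<longlonglongrightarrow> - f' (x - t *\<^sub>R e)"
          using X unfolding tendsto_at_iff_sequentially by (auto simp: o_def)
      qed
      show "AE x in lebesgue. norm (?q i x) \<le> C * \<bar>indicator ?T x * u x\<bar>" for i
      proof (rule AE_I2)
        fix x
        have Xi: "X i \<noteq> 0" using X by auto
        show "norm (?q i x) \<le> C * \<bar>indicator ?T x * u x\<bar>"
        proof (cases "x \<in> ?T")
          case True
          have "\<bar>(f (x - (t + X i) *\<^sub>R e) - f (x - t *\<^sub>R e)) / X i\<bar> \<le> C"
            using lip[of x "t + X i" t] Xi by (simp add: divide_simps)
          then have "\<bar>u x\<bar> * \<bar>(f (x - (t + X i) *\<^sub>R e) - f (x - t *\<^sub>R e)) / X i\<bar> \<le> \<bar>u x\<bar> * C"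
            by (rule mult_left_mono) simp
          then show ?thesis using True by (simp add: abs_mult mult.commute)
        next
          case False
          have "x - (t + X i) *\<^sub>R e \<notin> K"
            using inS[of x "t + X i" "\<bar>t\<bar> + R"] abs_triangle_ineq[of t "X i"] R[of i] False by linarith
          moreover have "x - t *\<^sub>R e \<notin> K"
            using inS[of x t "\<bar>t\<bar> + R"] R[of i] abs_ge_zero[of "X i"] False by linarith
          ultimately show ?thesis using False K(2) by simp
        qed
      qed
    qed
    moreover have "(LINT x|lebesgue. ?q i x) = (A (t + X i) - A t) / X i" for i
    proof -
      have "(LINT x|lebesgue. ?q i x) =
          (LINT x|lebesgue. (u x * f (x - (t + X i) *\<^sub>R e) - u x * f (x - t *\<^sub>R e)) / X i)"
        by (simp add: right_diff_distrib)
      then show ?thesis by (simp add: int A_def)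
    qed
    ultimately have "(\<lambda>i. (A (t + X i) - A t) / X i) \<longlonglongrightarrow> (LINT x|lebesgue. u x * - f' (x - t *\<^sub>R e))"
      by (simp only:)
    then show "((\<lambda>s. (A (t + s) - A t) / s) \<circ> X) \<longlonglongrightarrow> - (LINT x|lebesgue. u x * f' (x - t *\<^sub>R e))"
      by (simp add: o_def)
  qed
  then show ?thesis unfolding A_def DERIV_def .
qed

lemma integral_deriv_eq_0:
  fixes f f' :: "'a::euclidean_space \<Rightarrow> real"
  assumes cont: "continuous_on UNIV f" "continuous_on UNIV f'"
    and K: "compact K" "\<And>x. x \<notin> K \<Longrightarrow> f x = 0" "\<And>x. x \<notin> K \<Longrightarrow> f' x = 0"
    and deriv: "\<And>x. ((\<lambda>t. f (x + t *\<^sub>R e)) has_real_derivative f' x) (at 0)"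
  shows "(LINT x|lebesgue. f' x) = 0"
proof -
  have "((\<lambda>t. LINT x|lebesgue. 1 * f (x - t *\<^sub>R e)) has_real_derivative
      - (LINT x|lebesgue. 1 * f' (x - 0 *\<^sub>R e))) (at 0)"
    by (rule DERIV_integral_shift[OF const_L1loc assms])
  moreover have "(LINT x|lebesgue. 1 * f (x - t *\<^sub>R e)) = (LINT x|lebesgue. f x)" for t
    using integral_lebesgue_shift[OF continuous_imp_lebesgue_measurable[OF cont(1)]] by simp
  ultimately have "((\<lambda>t. LINT x|lebesgue. f x) has_real_derivative - (LINT x|lebesgue. f' x)) (at (0::real))"
    by simp
  then show ?thesis using DERIV_const DERIV_unique by fastforce
qed

section \<open>Density of test functions\<close>

text \<open>
  \<open>\<psi>\<close> is the almost everywhere limit of a uniformly bounded sequence in \<open>C\<^sub>c\<^sup>\<infinity>(\<Omega>)\<close> whose members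
  all vanish outside \<open>L\<close>.
\<close>
definition test_limit :: "'a::euclidean_space set \<Rightarrow> 'a set \<Rightarrow> ('a \<Rightarrow> real) \<Rightarrow> bool" where
  "test_limit \<Omega> L \<psi> \<longleftrightarrow> (\<exists>\<phi> B.
    (\<forall>n. \<phi> n \<in> Cc_infty \<Omega> \<and> (\<forall>x. \<bar>\<phi> n x\<bar> \<le> B) \<and> (\<forall>x. x \<notin> L \<longrightarrow> \<phi> n x = 0)) \<and>
    (AE x in lebesgue. (\<lambda>n::nat. \<phi> n x) \<longlonglongrightarrow> \<psi> x))"

text \<open>
  Bounded measurable functions supported in \<open>K\<close> are limits of test functions whose supports lie
  in a compact set depending on \<open>K\<close> only. With a test function \<open>\<eta>\<close> positive on \<open>K\<close>, the
  approximants are \<open>\<eta> p\<close> with polynomials \<open>p\<close> close to continuous approximations of \<open>\<psi>/\<eta>\<close>.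
\<close>
lemma test_limit_exists:
  fixes K \<Omega> :: "'a::euclidean_space set"
  assumes K: "compact K" "open \<Omega>" "K \<subseteq> \<Omega>"
  shows "\<exists>L. compact L \<and> L \<subseteq> \<Omega> \<and> K \<subseteq> L \<and>
    (\<forall>\<psi> M. \<psi> \<in> borel_measurable lebesgue \<and> (\<forall>x. \<bar>\<psi> x\<bar> \<le> M) \<and> (\<forall>x. x \<notin> K \<longrightarrow> \<psi> x = 0) \<longrightarrow>
      test_limit \<Omega> L \<psi>)"
proof -
  obtain \<eta> where \<eta>: "\<eta> \<in> Cc_infty \<Omega>" "\<And>x. 0 \<le> \<eta> x" "\<And>x. x \<in> K \<Longrightarrow> 0 < \<eta> x"
    using cutoff_exists[OF K] by metis
  obtain L where L: "compact L" "L \<subseteq> \<Omega>" "\<And>x. x \<notin> L \<Longrightarrow> \<eta> x = 0"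
    using Cc_inftyE[OF \<eta>(1)] by metis
  obtain E where E: "0 < E" "\<And>x. \<bar>\<eta> x\<bar> \<le> E"
    using continuous_compact_support_bounded[OF Cc_infty_continuous[OF \<eta>(1)] L(1,3)] by blast
  have "\<exists>m>0. \<forall>x\<in>K. m \<le> \<eta> x"
    using Cc_infty_continuous[OF \<eta>(1)] \<eta>(3)
    by (intro continuous_pos_lower_bound[OF K(1)]) (auto elim: continuous_on_subset)
  then obtain m where m: "m > 0" "\<And>x. x \<in> K \<Longrightarrow> m \<le> \<eta> x" by blast
  show ?thesis
  proof (intro exI[of _ L] conjI allI impI L)
    show "K \<subseteq> L" using \<eta>(3) L(3) by fastforce
    fix \<psi> :: "'a \<Rightarrow> real" and M :: real
    assume "\<psi> \<in> borel_measurable lebesgue \<and> (\<forall>x. \<bar>\<psi> x\<bar> \<le> M) \<and> (\<forall>x. x \<notin> K \<longrightarrow> \<psi> x = 0)"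
    then have \<psi>: "\<psi> \<in> borel_measurable lebesgue" "\<And>x. \<bar>\<psi> x\<bar> \<le> M" "\<And>x. x \<notin> K \<Longrightarrow> \<psi> x = 0"
      by auto
    have M: "0 \<le> M" using \<psi>(2)[of undefined] by linarith
    define h where "h x = \<psi> x / \<eta> x" for x
    have hb: "\<bar>h x\<bar> \<le> M / m" for x
    proof (cases "x \<in> K")
      case True
      then show ?thesis unfolding h_def abs_divide
        using \<psi>(2)[of x] m M by (intro frac_le) (auto simp: abs_of_pos \<eta>)
    next
      case False
      then show ?thesis using \<psi>(3) m M by (simp add: h_def)
    qed
    have "h \<in> borel_measurable (lebesgue_on UNIV)"
      unfolding h_def lebesgue_on_UNIV_eq
      by (intro borel_measurable_divide \<psi> continuous_imp_lebesgue_measurable Cc_infty_continuous[OF \<eta>(1)])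
    then have "h measurable_on UNIV"
      by (subst measurable_on_iff_borel_measurable) auto
    then obtain N f where N: "negligible N" "\<And>n. continuous_on UNIV (f n)"
        "\<And>x. x \<notin> N \<Longrightarrow> (\<lambda>n. f n x) \<longlonglongrightarrow> h x"
      unfolding measurable_on_def by auto
    define g where "g n x = max (- (M/m)) (min (M/m) (f n x))" for n x
    have gc: "continuous_on L (g n)" for n
      unfolding g_def by (intro continuous_intros continuous_on_subset[OF N(2)]) auto
    have gb: "\<bar>g n x\<bar> \<le> M/m" for n x
    proof -
      have "0 \<le> M / m" using M m by simp
      then show ?thesis unfolding g_def by linarith
    qed
    have glim: "(\<lambda>n. g n x) \<longlonglongrightarrow> h x" if "x \<notin> N" for x
    proof -
      have "(\<lambda>n. g n x) \<longlonglongrightarrow> max (- (M/m)) (min (M/m) (h x))"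
        unfolding g_def by (intro tendsto_intros N that)
      then show ?thesis using hb[of x] by (simp add: max_def min_def abs_le_iff split: if_splits)
    qed
    have "\<exists>p. real_polynomial_function p \<and> (\<forall>x\<in>L. \<bar>g n x - p x\<bar> < 1 / real (Suc n))" for n
      by (rule Stone_Weierstrass_real_polynomial_function[OF L(1) gc, of "1 / real (Suc n)" n]) (simp, blast)
    then obtain p where p: "\<And>n. real_polynomial_function (p n)"
        "\<And>n x. x \<in> L \<Longrightarrow> \<bar>g n x - p n x\<bar> < 1 / real (Suc n)"
      by metis
    define \<phi> where "\<phi> n x = \<eta> x * p n x" for n x
    have "\<phi> n \<in> Cc_infty \<Omega>" for n
      unfolding \<phi>_def by (intro Cc_infty_mult_smooth[OF \<eta>(1)] Ck_polynomial p)
    moreover have "\<bar>\<phi> n x\<bar> \<le> E * (M/m + 1)" for n x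
    proof (cases "x \<in> L")
      case True
      have "1 / real (Suc n) \<le> 1" by simp
      then have "\<bar>p n x\<bar> \<le> M/m + 1" using p(2)[OF True, of n] gb[of n x] by linarith
      then show ?thesis unfolding \<phi>_def abs_mult using E by (intro mult_mono) auto
    next
      case False
      then show ?thesis using L(3) E M m by (simp add: \<phi>_def)
    qed
    moreover have "\<phi> n x = 0" if "x \<notin> L" for n x
      using that L(3) by (simp add: \<phi>_def)
    moreover have "AE x in lebesgue. (\<lambda>n. \<phi> n x) \<longlonglongrightarrow> \<psi> x"
    proof -
      have lim: "(\<lambda>n. \<phi> n x) \<longlonglongrightarrow> \<psi> x" if "x \<notin> N" for x
      proof (cases "x \<in> L")
        case True
        have "(\<lambda>n. g n x - p n x) \<longlonglongrightarrow> 0"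
        proof (rule tendsto_rabs_zero_cancel, rule tendsto_sandwich[OF _ _ tendsto_const])
          show "(\<lambda>n. 1 / real (Suc n)) \<longlonglongrightarrow> 0" by (rule LIMSEQ_Suc[OF lim_1_over_n])
        qed (use p(2)[OF True] in \<open>auto intro!: always_eventually intro: less_imp_le\<close>)
        then have "(\<lambda>n. g n x - (g n x - p n x)) \<longlonglongrightarrow> h x - 0"
          by (intro tendsto_diff glim that)
        then have "(\<lambda>n. \<eta> x * p n x) \<longlonglongrightarrow> \<eta> x * h x"
          by (intro tendsto_mult_left) simp
        moreover have "\<eta> x * h x = \<psi> x"
        proof (cases "x \<in> K")
          case True
          then show ?thesis using \<eta>(3)[of x] by (simp add: h_def)
        qed (simp add: h_def \<psi>)
        ultimately show ?thesis by (simp add: \<phi>_def)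
      next
        case False
        then have "x \<notin> K" using \<eta>(3)[of x] L(3)[of x] by auto
        then show ?thesis using False L(3) \<psi>(3) by (simp add: \<phi>_def)
      qed
      have "N \<in> null_sets lebesgue" using N(1) by (simp add: negligible_iff_null_sets)
      then show ?thesis by (rule AE_I') (use lim in auto)
    qed
    ultimately show "test_limit \<Omega> L \<psi>"
      unfolding test_limit_def by (intro exI[of _ \<phi>] exI[of _ "E * (M/m + 1)"]) auto
  qed
qed

section \<open>Weak gradients and square integrable functions\<close>

lemma integral_lebesgue_on_support:
  fixes f :: "'a::euclidean_space \<Rightarrow> real"
  assumes "open \<Omega>" "\<And>x. x \<notin> \<Omega> \<Longrightarrow> f x = 0"
  shows "(LINT x|lebesgue_on \<Omega>. f x) = (LINT x|lebesgue. f x)"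
    and "integrable (lebesgue_on \<Omega>) f \<longleftrightarrow> integrable lebesgue f"
proof -
  have eq: "(\<lambda>x. if x \<in> \<Omega> then f x else 0) = f" using assms(2) by auto
  have "\<Omega> \<in> sets lebesgue" using assms(1) by simp
  then show "(LINT x|lebesgue_on \<Omega>. f x) = (LINT x|lebesgue. f x)"
    "integrable (lebesgue_on \<Omega>) f \<longleftrightarrow> integrable lebesgue f"
    using Lebesgue_Measure.integral_restrict_UNIV[of \<Omega> f] Lebesgue_Measure.integrable_restrict_UNIV[of \<Omega> f] unfolding eq by simp_all
qed

lemma AE_lebesgue_on_iff:
  "open \<Omega> \<Longrightarrow> (AE x in lebesgue_on \<Omega>. P x) \<longleftrightarrow> (AE x in lebesgue. x \<in> \<Omega> \<longrightarrow> P x)"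
  by (subst AE_restrict_space_iff) auto

lemma measurable_lebesgue_on_AE:
  fixes f g :: "'a::euclidean_space \<Rightarrow> 'b::euclidean_space"
  assumes "open \<Omega>" "f \<in> borel_measurable (lebesgue_on \<Omega>)" "AE x in lebesgue_on \<Omega>. f x = g x"
  shows "g \<in> borel_measurable (lebesgue_on \<Omega>)"
proof -
  have ae: "AE x in lebesgue. (if x \<in> \<Omega> then f x else 0) = (if x \<in> \<Omega> then g x else 0)"
    using assms(3) unfolding AE_lebesgue_on_iff[OF assms(1)] by eventually_elim auto
  have "\<Omega> \<in> sets lebesgue" using assms(1) by simp
  then have "(\<lambda>x. if x \<in> \<Omega> then g x else 0) \<in> borel_measurable lebesgue"
    using borel_measurable_AE[OF borel_measurable_if_I[OF assms(2)] ae] by simp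
  then show ?thesis by (rule borel_measurable_if_D)
qed

lemma test_mult_integrable:
  assumes "open \<Omega>" "f \<in> L1loc \<Omega>" "\<phi> \<in> Cc_infty \<Omega>"
  shows "integrable (lebesgue_on \<Omega>) (\<lambda>x. f x * \<phi> x)"
    and "i \<in> Basis \<Longrightarrow> integrable (lebesgue_on \<Omega>) (\<lambda>x. f x * frechet_derivative \<phi> (at x) i)"
proof -
  obtain K where K: "compact K" "K \<subseteq> \<Omega>" "\<And>x. x \<notin> K \<Longrightarrow> \<phi> x = 0"
      "\<And>x h. x \<notin> K \<Longrightarrow> frechet_derivative \<phi> (at x) h = 0"
    using Cc_inftyE[OF assms(3)] by metis
  have *: "integrable (lebesgue_on \<Omega>) (\<lambda>x. f x * \<psi> x)"
    if c: "continuous_on UNIV \<psi>" and z: "\<And>x. x \<notin> K \<Longrightarrow> \<psi> x = 0" for \<psi>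
  proof -
    obtain C where "\<And>x. \<bar>\<psi> x\<bar> \<le> C"
      using continuous_compact_support_bounded[OF c K(1) z] by blast
    then have "integrable lebesgue (\<lambda>x. f x * \<psi> x)"
      using L1loc_mult_integrable[OF assms(2) continuous_imp_lebesgue_measurable[OF c] _ K(1) z K(2)] by blast
    then show ?thesis using z K(2)
      by (subst integral_lebesgue_on_support(2)[OF assms(1)]) auto
  qed
  show "integrable (lebesgue_on \<Omega>) (\<lambda>x. f x * \<phi> x)"
    using * Cc_infty_continuous[OF assms(3)] K by blast
  show "integrable (lebesgue_on \<Omega>) (\<lambda>x. f x * frechet_derivative \<phi> (at x) i)" if "i \<in> Basis"
    using * Cc_infty_continuous_deriv[OF assms(3) that] K by blast
qed

text \<open>The fundamental lemma of the calculus of variations.\<close>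
lemma test_integrals_zero_imp_AE_zero:
  fixes f :: "'a::euclidean_space \<Rightarrow> real"
  assumes "open \<Omega>" "f \<in> L1loc \<Omega>"
    and zero: "\<And>\<phi>. \<phi> \<in> Cc_infty \<Omega> \<Longrightarrow> (LINT x|lebesgue_on \<Omega>. f x * \<phi> x) = 0"
  shows "AE x in lebesgue_on \<Omega>. f x = 0"
proof -
  have K0: "AE x in lebesgue. x \<in> K \<longrightarrow> f x = 0" if K: "compact K" "K \<subseteq> \<Omega>" for K
  proof -
    obtain L where L: "compact L" "L \<subseteq> \<Omega>" "K \<subseteq> L"
      "\<forall>\<psi> M. \<psi> \<in> borel_measurable lebesgue \<and> (\<forall>x. \<bar>\<psi> x\<bar> \<le> M) \<and> (\<forall>x. x \<notin> K \<longrightarrow> \<psi> x = 0) \<longrightarrow>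
        test_limit \<Omega> L \<psi>"
      using test_limit_exists[OF K(1) assms(1) K(2)] by blast
    define F where "F x = indicator L x * f x" for x
    have F: "integrable lebesgue F"
      using assms(2) L(1,2) by (auto simp: L1loc_def set_integrable_def F_def[abs_def])
    note Fm[measurable] = borel_measurable_integrable[OF F]
    have [measurable]: "K \<in> sets lebesgue" using K by (simp add: compact_imp_closed)
    define \<psi> where "\<psi> x = indicator K x * sgn (F x)" for x
    have \<psi>m[measurable]: "\<psi> \<in> borel_measurable lebesgue" unfolding \<psi>_def[abs_def] by measurable
    have "\<forall>x. \<bar>\<psi> x\<bar> \<le> 1" "\<forall>x. x \<notin> K \<longrightarrow> \<psi> x = 0"
      by (auto simp: \<psi>_def indicator_def sgn_if)
    then have "test_limit \<Omega> L \<psi>" using L(4) \<psi>m by blast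
    then obtain \<phi> B where \<phi>: "\<And>n. \<phi> n \<in> Cc_infty \<Omega>" "\<And>n x. \<bar>\<phi> n x\<bar> \<le> B"
        "\<And>n x. x \<notin> L \<Longrightarrow> \<phi> n x = 0" "AE x in lebesgue. (\<lambda>n. \<phi> n x) \<longlonglongrightarrow> \<psi> x"
      unfolding test_limit_def by blast
    have "(LINT x|lebesgue. F x * \<phi> n x) = 0" for n
    proof -
      have "(LINT x|lebesgue. F x * \<phi> n x) = (LINT x|lebesgue. f x * \<phi> n x)"
        using \<phi>(3) by (intro Bochner_Integration.integral_cong) (auto simp: F_def indicator_def)
      also have "\<dots> = (LINT x|lebesgue_on \<Omega>. f x * \<phi> n x)"
        using \<phi>(3) L(2) by (subst integral_lebesgue_on_support(1)[OF assms(1)]) auto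
      finally show ?thesis using zero[OF \<phi>(1)] by simp
    qed
    moreover have "(\<lambda>n. LINT x|lebesgue. F x * \<phi> n x) \<longlonglongrightarrow> (LINT x|lebesgue. F x * \<psi> x)"
    proof (rule integral_dominated_convergence[where w="\<lambda>x. B * \<bar>F x\<bar>"])
      have [measurable]: "\<phi> n \<in> borel_measurable lebesgue" for n
        using continuous_imp_lebesgue_measurable[OF Cc_infty_continuous[OF \<phi>(1)]] .
      show "(\<lambda>x. F x * \<phi> n x) \<in> borel_measurable lebesgue" for n by measurable
      show "AE x in lebesgue. (\<lambda>n. F x * \<phi> n x) \<longlonglongrightarrow> F x * \<psi> x"
        using \<phi>(4) by eventually_elim (rule tendsto_mult_left)
      show "AE x in lebesgue. norm (F x * \<phi> n x) \<le> B * \<bar>F x\<bar>" for n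
        using mult_right_mono[OF \<phi>(2)[of n] abs_ge_zero[of "F _"]] by (simp add: abs_mult mult.commute)
    qed (use F in auto)
    ultimately have "(\<lambda>n::nat. 0) \<longlonglongrightarrow> (LINT x|lebesgue. F x * \<psi> x)" by (simp only:)
    then have z: "(LINT x|lebesgue. F x * \<psi> x) = 0" by (simp add: LIMSEQ_const_iff)
    have eq: "F x * \<psi> x = indicator K x * \<bar>f x\<bar>" for x
      using L(3) by (auto simp: F_def \<psi>_def indicator_def sgn_if)
    have "integrable lebesgue (\<lambda>x. indicator K x * \<bar>F x\<bar>)"
      by (rule integrable_mult_indicator[of K lebesgue "\<lambda>x. \<bar>F x\<bar>", simplified real_scaleR_def]) (use F in auto)
    moreover have "(\<lambda>x. indicator K x * \<bar>F x\<bar>) = (\<lambda>x. F x * \<psi> x)"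
      using L(3) by (auto simp: F_def \<psi>_def indicator_def sgn_if)
    ultimately have "integrable lebesgue (\<lambda>x. F x * \<psi> x)" by simp
    then have "AE x in lebesgue. F x * \<psi> x = 0"
      using z eq by (subst (asm) integral_nonneg_eq_0_iff_AE) auto
    then show ?thesis
      unfolding eq by eventually_elim (auto simp: indicator_def)
  qed
  obtain C where C: "\<And>n::nat. compact (C n)" "\<And>n. C n \<subseteq> \<Omega>" "\<Union>(range C) = \<Omega>"
    using open_Union_compact_subsets[OF assms(1)] by metis
  have "AE x in lebesgue. \<forall>n. x \<in> C n \<longrightarrow> f x = 0"
    unfolding AE_all_countable using K0 C by blast
  then have "AE x in lebesgue. x \<in> \<Omega> \<longrightarrow> f x = 0"
    by eventually_elim (use C(3) in auto)
  then show ?thesis by (simp add: AE_lebesgue_on_iff[OF assms(1)])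
qed

lemma L1loc_inner:
  assumes "g \<in> L1loc \<Omega>" shows "(\<lambda>x. g x \<bullet> i) \<in> L1loc \<Omega>"
proof -
  have "(\<lambda>x. g x \<bullet> i) absolutely_integrable_on K" if "g absolutely_integrable_on K" for K
    using that absolutely_integrable_linear[OF that bounded_linear_inner_left[of i]] by (simp add: o_def)
  then show ?thesis using assms by (auto simp: L1loc_def)
qed

lemma L1loc_add_cmult:
  assumes "f \<in> L1loc \<Omega>" "g \<in> L1loc \<Omega>"
  shows "(\<lambda>x. f x + a *\<^sub>R g x) \<in> L1loc \<Omega>"
  using assms by (auto simp: L1loc_def intro!: set_integral_add absolutely_integrable_scaleR_left)

lemma has_weak_gradient_unique:
  assumes "open \<Omega>" "has_weak_gradient \<Omega> u g" "has_weak_gradient \<Omega> u h"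
  shows "AE x in lebesgue_on \<Omega>. g x = h x"
proof -
  have "AE x in lebesgue_on \<Omega>. (g x - h x) \<bullet> i = 0" if i: "i \<in> Basis" for i
  proof (rule test_integrals_zero_imp_AE_zero[OF assms(1)])
    have L: "g \<in> L1loc \<Omega>" "h \<in> L1loc \<Omega>" using assms(2,3) by (auto simp: has_weak_gradient_def)
    show "(\<lambda>x. (g x - h x) \<bullet> i) \<in> L1loc \<Omega>"
      using L1loc_inner[OF L1loc_add_cmult[OF L, of "-1"]] by simp
    fix \<phi> assume \<phi>: "\<phi> \<in> Cc_infty \<Omega>"
    have "(LINT x|lebesgue_on \<Omega>. (g x \<bullet> i) * \<phi> x) = (LINT x|lebesgue_on \<Omega>. (h x \<bullet> i) * \<phi> x)"
      using assms(2,3) \<phi> i by (force simp: has_weak_gradient_def)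
    then show "(LINT x|lebesgue_on \<Omega>. (g x - h x) \<bullet> i * \<phi> x) = 0"
      using test_mult_integrable(1)[OF assms(1) L1loc_inner[OF L(1)] \<phi>, of i]
        test_mult_integrable(1)[OF assms(1) L1loc_inner[OF L(2)] \<phi>, of i]
      by (simp add: inner_diff_left left_diff_distrib)
  qed
  then have "AE x in lebesgue_on \<Omega>. \<forall>i\<in>Basis. (g x - h x) \<bullet> i = 0"
    by (subst AE_ball_countable) (auto simp: countable_finite)
  then show ?thesis
    by eventually_elim (metis euclidean_all_zero_iff right_minus_eq)
qed

lemma weak_gradient_AE_eq:
  assumes "open \<Omega>" "has_weak_gradient \<Omega> u g"
  shows "AE x in lebesgue_on \<Omega>. weak_gradient \<Omega> u x = g x"
  unfolding weak_gradient_def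
  by (rule has_weak_gradient_unique[OF assms(1) someI[of "has_weak_gradient \<Omega> u", OF assms(2)] assms(2)])

lemma weak_gradient_measurable:
  assumes "open \<Omega>" "has_weak_gradient \<Omega> u g" "g \<in> borel_measurable (lebesgue_on \<Omega>)"
  shows "weak_gradient \<Omega> u \<in> borel_measurable (lebesgue_on \<Omega>)"
  by (rule measurable_lebesgue_on_AE[OF assms(1,3)])
    (use weak_gradient_AE_eq[OF assms(1,2)] in eventually_elim, simp)

lemma has_weak_gradient_add_cmult:
  assumes "open \<Omega>" "has_weak_gradient \<Omega> u g" "has_weak_gradient \<Omega> v h"
  shows "has_weak_gradient \<Omega> (\<lambda>x. u x + a * v x) (\<lambda>x. g x + a *\<^sub>R h x)"
  unfolding has_weak_gradient_def
proof (intro conjI ballI)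
  have L: "g \<in> L1loc \<Omega>" "h \<in> L1loc \<Omega>" "u \<in> L1loc \<Omega>" "v \<in> L1loc \<Omega>"
    using assms(2,3) by (auto simp: has_weak_gradient_def)
  show "(\<lambda>x. u x + a * v x) \<in> L1loc \<Omega>" using L1loc_add_cmult[OF L(3,4), of a] by simp
  show "(\<lambda>x. g x + a *\<^sub>R h x) \<in> L1loc \<Omega>" using L1loc_add_cmult[OF L(1,2)] .
  fix \<phi> i assume \<phi>: "\<phi> \<in> Cc_infty \<Omega>" and i: "i \<in> (Basis :: 'a set)"
  note int = test_mult_integrable(2)[OF assms(1) L(3) \<phi> i] test_mult_integrable(2)[OF assms(1) L(4) \<phi> i]
    test_mult_integrable(1)[OF assms(1) L1loc_inner[OF L(1)] \<phi>, of i]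
    test_mult_integrable(1)[OF assms(1) L1loc_inner[OF L(2)] \<phi>, of i]
  have "(LINT x|lebesgue_on \<Omega>. (u x + a * v x) * frechet_derivative \<phi> (at x) i)
      = (LINT x|lebesgue_on \<Omega>. u x * frechet_derivative \<phi> (at x) i)
        + a * (LINT x|lebesgue_on \<Omega>. v x * frechet_derivative \<phi> (at x) i)"
    using int by (simp add: distrib_right mult.assoc)
  also have "\<dots> = - ((LINT x|lebesgue_on \<Omega>. (g x \<bullet> i) * \<phi> x)
        + a * (LINT x|lebesgue_on \<Omega>. (h x \<bullet> i) * \<phi> x))"
    using assms(2,3) \<phi> i by (simp add: has_weak_gradient_def)
  also have "\<dots> = - (LINT x|lebesgue_on \<Omega>. ((g x + a *\<^sub>R h x) \<bullet> i) * \<phi> x)"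
    using int by (simp add: distrib_right mult.assoc inner_add_left)
  finally show "(LINT x|lebesgue_on \<Omega>. (u x + a * v x) * frechet_derivative \<phi> (at x) i) =
      - (LINT x|lebesgue_on \<Omega>. ((g x + a *\<^sub>R h x) \<bullet> i) * \<phi> x)" .
qed

text \<open>The classical gradient, assembled from the partial derivatives.\<close>
definition grad :: "('a::euclidean_space \<Rightarrow> real) \<Rightarrow> 'a \<Rightarrow> 'a" where
  "grad \<phi> x = (\<Sum>i\<in>Basis. frechet_derivative \<phi> (at x) i *\<^sub>R i)"

lemma grad_inner: "i \<in> Basis \<Longrightarrow> grad \<phi> x \<bullet> i = frechet_derivative \<phi> (at x) i"
  by (simp add: grad_def)

lemma grad_continuous:
  "\<phi> \<in> Cc_infty \<Omega> \<Longrightarrow> continuous_on UNIV (grad \<phi>)"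
  unfolding grad_def[abs_def]
  by (intro continuous_intros continuous_on_sum) (auto dest: Cc_infty_continuous_deriv)

lemma continuous_L1loc:
  fixes f :: "'a::euclidean_space \<Rightarrow> 'b::euclidean_space"
  assumes "continuous_on UNIV f" shows "f \<in> L1loc \<Omega>"
  unfolding L1loc_def
proof (intro CollectI allI impI)
  fix K assume "compact K \<and> K \<subseteq> \<Omega>"
  then have i: "integrable lborel (\<lambda>x. indicator K x *\<^sub>R f x)"
    using assms by (intro borel_integrable_compact) (auto elim: continuous_on_subset)
  then show "f absolutely_integrable_on K"
    using integrable_completion[OF borel_measurable_integrable[OF i]]
    by (simp add: set_integrable_def)
qed

lemma directional_derivative:
  assumes "(f has_derivative f') (at x)"
  shows "((\<lambda>t. f (x + t *\<^sub>R e)) has_real_derivative f' e) (at 0)"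
proof -
  have "((\<lambda>t::real. x + t *\<^sub>R e) has_derivative (\<lambda>t. t *\<^sub>R e)) (at 0)"
    by (auto intro!: derivative_eq_intros)
  moreover have "(f has_derivative f') (at (x + 0 *\<^sub>R e))" using assms by simp
  ultimately have "((\<lambda>t. f (x + t *\<^sub>R e)) has_derivative (\<lambda>t. f' (t *\<^sub>R e))) (at 0)"
    by (rule has_derivative_compose)
  moreover have "f' (t *\<^sub>R e) = f' e * t" for t
    using has_derivative_bounded_linear[OF assms] by (simp add: linear_simps)
  ultimately show ?thesis by (simp add: has_field_derivative_def)
qed

lemma test_has_weak_gradient:
  assumes "open \<Omega>" "\<phi> \<in> Cc_infty \<Omega>"
  shows "has_weak_gradient \<Omega> \<phi> (grad \<phi>)"
  unfolding has_weak_gradient_def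
proof (intro conjI ballI)
  show "\<phi> \<in> L1loc \<Omega>" "grad \<phi> \<in> L1loc \<Omega>"
    using continuous_L1loc Cc_infty_continuous[OF assms(2)] grad_continuous[OF assms(2)] by auto
  note L = this
  fix \<theta> i assume \<theta>: "\<theta> \<in> Cc_infty \<Omega>" and i: "i \<in> (Basis :: 'a set)"
  let ?f' = "\<lambda>x. \<phi> x * frechet_derivative \<theta> (at x) i + frechet_derivative \<phi> (at x) i * \<theta> x"
  obtain K where K: "compact K" "K \<subseteq> \<Omega>" "\<And>x. x \<notin> K \<Longrightarrow> \<phi> x = 0"
      "\<And>x h. x \<notin> K \<Longrightarrow> frechet_derivative \<phi> (at x) h = 0"
    using Cc_inftyE[OF assms(2)] by metis
  have "(LINT x|lebesgue. ?f' x) = 0"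
  proof (rule integral_deriv_eq_0[where f="\<lambda>x. \<phi> x * \<theta> x" and K=K and e=i])
    show "continuous_on UNIV (\<lambda>x. \<phi> x * \<theta> x)" "continuous_on UNIV ?f'"
      using Cc_infty_continuous[OF assms(2)] Cc_infty_continuous[OF \<theta>]
        Cc_infty_continuous_deriv[OF assms(2) i] Cc_infty_continuous_deriv[OF \<theta> i]
      by (auto intro!: continuous_intros)
    show "((\<lambda>t. \<phi> (x + t *\<^sub>R i) * \<theta> (x + t *\<^sub>R i)) has_real_derivative ?f' x) (at 0)" for x
      by (rule directional_derivative has_derivative_mult Cc_infty_has_derivative assms \<theta>)+
  qed (use K in auto)
  moreover have "(LINT x|lebesgue. ?f' x) = (LINT x|lebesgue_on \<Omega>. ?f' x)"
  proof (rule integral_lebesgue_on_support(1)[OF assms(1), symmetric])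
    fix x assume "x \<notin> \<Omega>"
    then have "x \<notin> K" using K(2) by blast
    then show "?f' x = 0" by (simp add: K(3,4))
  qed
  ultimately show "(LINT x|lebesgue_on \<Omega>. \<phi> x * frechet_derivative \<theta> (at x) i) =
      - (LINT x|lebesgue_on \<Omega>. (grad \<phi> x \<bullet> i) * \<theta> x)"
    using test_mult_integrable(2)[OF assms(1) L(1) \<theta> i]
      test_mult_integrable(1)[OF assms(1) L1loc_inner[OF L(2), of i] \<theta>]
    by (simp add: grad_inner[OF i])
qed

lemma const_has_weak_gradient:
  assumes "open \<Omega>" shows "has_weak_gradient \<Omega> (\<lambda>x. c) (\<lambda>x. 0)"
  unfolding has_weak_gradient_def
proof (intro conjI ballI)
  show "(\<lambda>x. c) \<in> L1loc \<Omega>" "(\<lambda>x. 0) \<in> L1loc \<Omega>" by (auto intro!: continuous_L1loc)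
  fix \<phi> i assume \<phi>: "\<phi> \<in> Cc_infty \<Omega>" and i: "i \<in> (Basis :: 'a set)"
  obtain K where K: "compact K" "K \<subseteq> \<Omega>" "\<And>x. x \<notin> K \<Longrightarrow> \<phi> x = 0"
      "\<And>x h. x \<notin> K \<Longrightarrow> frechet_derivative \<phi> (at x) h = 0"
    using Cc_inftyE[OF \<phi>] by metis
  have "(LINT x|lebesgue. frechet_derivative \<phi> (at x) i) = 0"
    by (rule integral_deriv_eq_0[OF Cc_infty_continuous[OF \<phi>] Cc_infty_continuous_deriv[OF \<phi> i] K(1,3,4)
        directional_derivative[OF Cc_infty_has_derivative[OF \<phi>]]])
  moreover have "(LINT x|lebesgue. frechet_derivative \<phi> (at x) i) = (LINT x|lebesgue_on \<Omega>. frechet_derivative \<phi> (at x) i)"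
    using K by (subst integral_lebesgue_on_support(1)[OF assms(1)]) auto
  ultimately show "(LINT x|lebesgue_on \<Omega>. c * frechet_derivative \<phi> (at x) i) =
      - (LINT x|lebesgue_on \<Omega>. 0 \<bullet> i * \<phi> x)" by simp
qed

lemma L2_measurable: "f \<in> L2 \<Omega> \<Longrightarrow> f \<in> borel_measurable (lebesgue_on \<Omega>)"
  by (simp add: L2_def)

lemma L2_integrable_square: "f \<in> L2 \<Omega> \<Longrightarrow> integrable (lebesgue_on \<Omega>) (\<lambda>x. (norm (f x))\<^sup>2)"
  by (simp add: L2_def)

lemma L2_bound:
  fixes f :: "'a::euclidean_space \<Rightarrow> 'b::euclidean_space"
  assumes "f \<in> borel_measurable (lebesgue_on \<Omega>)" "integrable (lebesgue_on \<Omega>) h"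
    "AE x in lebesgue_on \<Omega>. (norm (f x))\<^sup>2 \<le> h x"
  shows "f \<in> L2 \<Omega>"
  unfolding L2_def
proof (intro CollectI conjI)
  show "integrable (lebesgue_on \<Omega>) (\<lambda>x. (norm (f x))\<^sup>2)"
    by (rule Bochner_Integration.integrable_bound[OF assms(2)])
      (use assms(1) in measurable, use assms(3) in eventually_elim, auto)
qed (rule assms)

lemma L2_inner_integrable:
  fixes f g :: "'a::euclidean_space \<Rightarrow> 'b::euclidean_space"
  assumes "f \<in> L2 \<Omega>" "g \<in> L2 \<Omega>"
  shows "integrable (lebesgue_on \<Omega>) (\<lambda>x. f x \<bullet> g x)"
proof (rule Bochner_Integration.integrable_bound)
  show "integrable (lebesgue_on \<Omega>) (\<lambda>x. (norm (f x))\<^sup>2 + (norm (g x))\<^sup>2)"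
    using assms by (intro Bochner_Integration.integrable_add L2_integrable_square)
  show "(\<lambda>x. f x \<bullet> g x) \<in> borel_measurable (lebesgue_on \<Omega>)"
    using assms by (intro borel_measurable_inner L2_measurable)
  have "\<bar>f x \<bullet> g x\<bar> \<le> (norm (f x))\<^sup>2 + (norm (g x))\<^sup>2" for x
    using Cauchy_Schwarz_ineq2[of "f x" "g x"] sum_squares_bound[of "norm (f x)" "norm (g x)"]
      mult_nonneg_nonneg[OF norm_ge_zero[of "f x"] norm_ge_zero[of "g x"]] by linarith
  then show "AE x in lebesgue_on \<Omega>. norm (f x \<bullet> g x) \<le> norm ((norm (f x))\<^sup>2 + (norm (g x))\<^sup>2)"
    by simp
qed

lemma L2_mult_integrable:
  fixes f g :: "'a::euclidean_space \<Rightarrow> real"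
  shows "f \<in> L2 \<Omega> \<Longrightarrow> g \<in> L2 \<Omega> \<Longrightarrow> integrable (lebesgue_on \<Omega>) (\<lambda>x. f x * g x)"
  using L2_inner_integrable[of f \<Omega> g] by simp

lemma norm_add_square_le: "(norm (a + b))\<^sup>2 \<le> 2 * (norm a)\<^sup>2 + 2 * (norm (b::'b::real_inner))\<^sup>2"
  by (smt (verit) norm_triangle_ineq power_mono norm_ge_zero sum_squares_bound power2_sum)

lemma L2_add_cmult:
  fixes f g :: "'a::euclidean_space \<Rightarrow> 'b::euclidean_space"
  assumes "f \<in> L2 \<Omega>" "g \<in> L2 \<Omega>"
  shows "(\<lambda>x. f x + a *\<^sub>R g x) \<in> L2 \<Omega>"
proof (rule L2_bound)
  show "integrable (lebesgue_on \<Omega>) (\<lambda>x. 2 * (norm (f x))\<^sup>2 + (2 * a\<^sup>2) * (norm (g x))\<^sup>2)"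
    using assms by (intro Bochner_Integration.integrable_add integrable_mult_right L2_integrable_square)
  show "(\<lambda>x. f x + a *\<^sub>R g x) \<in> borel_measurable (lebesgue_on \<Omega>)"
    using assms[THEN L2_measurable] by measurable
  show "AE x in lebesgue_on \<Omega>. (norm (f x + a *\<^sub>R g x))\<^sup>2 \<le> 2 * (norm (f x))\<^sup>2 + (2 * a\<^sup>2) * (norm (g x))\<^sup>2"
  proof (rule AE_I2)
    fix x
    show "(norm (f x + a *\<^sub>R g x))\<^sup>2 \<le> 2 * (norm (f x))\<^sup>2 + (2 * a\<^sup>2) * (norm (g x))\<^sup>2"
      using norm_add_square_le[of "f x" "a *\<^sub>R g x"] by (simp add: power_mult_distrib)
  qed
qed

lemma L2_diff:
  fixes f g :: "'a::euclidean_space \<Rightarrow> 'b::euclidean_space"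
  shows "f \<in> L2 \<Omega> \<Longrightarrow> g \<in> L2 \<Omega> \<Longrightarrow> (\<lambda>x. f x - g x) \<in> L2 \<Omega>"
  using L2_add_cmult[of f \<Omega> g "-1"] by simp

lemma L2_imp_L1loc:
  fixes f :: "'a::euclidean_space \<Rightarrow> 'b::euclidean_space"
  assumes "open \<Omega>" "f \<in> L2 \<Omega>"
  shows "f \<in> L1loc \<Omega>"
  unfolding L1loc_def
proof (intro CollectI allI impI)
  fix K assume K: "compact K \<and> K \<subseteq> \<Omega>"
  have Km: "K \<in> sets lebesgue" and Om: "\<Omega> \<in> sets lebesgue"
    using K assms(1) by (simp_all add: compact_imp_closed)
  have "integrable lebesgue (\<lambda>x. indicator K x *\<^sub>R f x)"
  proof (rule Bochner_Integration.integrable_bound)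
    have "integrable lebesgue (\<lambda>x. if x \<in> \<Omega> then (norm (f x))\<^sup>2 else 0)"
      using L2_integrable_square[OF assms(2)] Om by (simp add: Lebesgue_Measure.integrable_restrict_UNIV)
    moreover have "integrable lebesgue (indicator K :: 'a \<Rightarrow> real)"
      using K lmeasurable_compact by (auto simp: integrable_indicator_iff fmeasurable_def)
    ultimately show "integrable lebesgue (\<lambda>x. indicator K x + (if x \<in> \<Omega> then (norm (f x))\<^sup>2 else 0))"
      by simp
    have "(\<lambda>x. indicator K x *\<^sub>R (if x \<in> \<Omega> then f x else 0)) \<in> borel_measurable lebesgue"
      using L2_measurable[OF assms(2)] Km Om by (intro borel_measurable_scaleR borel_measurable_indicator) (simp_all add: borel_measurable_if)
    moreover have "(\<lambda>x. indicator K x *\<^sub>R (if x \<in> \<Omega> then f x else 0)) = (\<lambda>x. indicator K x *\<^sub>R f x)"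
      by (rule ext) (use K in \<open>auto simp: indicator_def\<close>)
    ultimately show "(\<lambda>x. indicator K x *\<^sub>R f x) \<in> borel_measurable lebesgue" by simp
    have "norm (f x) \<le> 1 + (norm (f x))\<^sup>2" for x
      using sum_squares_bound[of 1 "norm (f x)"] norm_ge_zero[of "f x"]
      unfolding power_one by linarith
    then show "AE x in lebesgue. norm (indicator K x *\<^sub>R f x) \<le> norm (indicator K x + (if x \<in> \<Omega> then (norm (f x))\<^sup>2 else 0))"
      using K by (auto simp: indicator_def)
  qed
  then show "f absolutely_integrable_on K" by (simp add: set_integrable_def)
qed

lemma continuous_compact_support_L2:
  fixes f :: "'a::euclidean_space \<Rightarrow> 'b::euclidean_space"
  assumes "continuous_on UNIV f" "compact K" "\<And>x. x \<notin> K \<Longrightarrow> f x = 0" "open \<Omega>" "K \<subseteq> \<Omega>"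
  shows "f \<in> L2 \<Omega>"
  unfolding L2_def
proof (intro CollectI conjI)
  show "f \<in> borel_measurable (lebesgue_on \<Omega>)"
    using continuous_imp_lebesgue_measurable[OF assms(1)] by (rule measurable_restrict_space1)
  have c: "continuous_on UNIV (\<lambda>x. (norm (f x))\<^sup>2)"
    using assms(1) by (intro continuous_intros)
  obtain C where "\<And>x. \<bar>(norm (f x))\<^sup>2\<bar> \<le> C"
    using continuous_compact_support_bounded[OF c assms(2)] assms(3)
    by (metis norm_zero power_zero_numeral)
  then have "integrable lebesgue (\<lambda>x. 1 * (norm (f x))\<^sup>2)"
    by (intro L1loc_mult_integrable[OF const_L1loc[of 1 UNIV] continuous_imp_lebesgue_measurable[OF c], of C K])
      (use assms in auto)
  then show "integrable (lebesgue_on \<Omega>) (\<lambda>x. (norm (f x))\<^sup>2)"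
    using assms by (subst integral_lebesgue_on_support(2)) auto
qed

lemma test_L2: "open \<Omega> \<Longrightarrow> \<phi> \<in> Cc_infty \<Omega> \<Longrightarrow> \<phi> \<in> L2 \<Omega>"
  using continuous_compact_support_L2[OF Cc_infty_continuous] Cc_inftyE by metis

lemma grad_test_L2:
  assumes "open \<Omega>" "\<phi> \<in> Cc_infty \<Omega>" shows "grad \<phi> \<in> L2 \<Omega>"
proof -
  obtain K where K: "compact K" "K \<subseteq> \<Omega>" "\<And>x h. x \<notin> K \<Longrightarrow> frechet_derivative \<phi> (at x) h = 0"
    using Cc_inftyE[OF assms(2)] by metis
  show ?thesis
    by (rule continuous_compact_support_L2[OF grad_continuous[OF assms(2)] K(1) _ assms(1) K(2)])
      (simp add: grad_def K)
qed

lemma H1I: "open \<Omega> \<Longrightarrow> u \<in> L2 \<Omega> \<Longrightarrow> g \<in> L2 \<Omega> \<Longrightarrow> has_weak_gradient \<Omega> u g \<Longrightarrow> u \<in> H1 \<Omega>"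
  by (auto simp: H1_def)

lemma H1_norm_eq:
  assumes "open \<Omega>" "g \<in> L2 \<Omega>" "has_weak_gradient \<Omega> u g"
  shows "H1_norm \<Omega> u = sqrt ((LINT x|lebesgue_on \<Omega>. (u x)\<^sup>2) + (LINT x|lebesgue_on \<Omega>. (norm (g x))\<^sup>2))"
proof -
  have "(LINT x|lebesgue_on \<Omega>. (norm (weak_gradient \<Omega> u x))\<^sup>2) = (LINT x|lebesgue_on \<Omega>. (norm (g x))\<^sup>2)"
  proof (rule integral_cong_AE)
    show "AE x in lebesgue_on \<Omega>. (norm (weak_gradient \<Omega> u x))\<^sup>2 = (norm (g x))\<^sup>2"
      using weak_gradient_AE_eq[OF assms(1,3)] by eventually_elim simp
  qed (use weak_gradient_measurable[OF assms(1,3) L2_measurable[OF assms(2)]] L2_measurable[OF assms(2)] in auto)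
  then show ?thesis by (simp add: H1_norm_def)
qed

text \<open>
  Membership in \<open>H10\<close>, with the distance to test functions measured by the squared norm and an
  arbitrary representative \<open>g\<close> of the weak gradient.
\<close>
lemma H10_iff:
  assumes "open \<Omega>" "v \<in> L2 \<Omega>" "g \<in> L2 \<Omega>" "has_weak_gradient \<Omega> v g"
  shows "v \<in> H10 \<Omega> \<longleftrightarrow> (\<forall>\<epsilon>>0. \<exists>\<phi>\<in>Cc_infty \<Omega>.
    (LINT x|lebesgue_on \<Omega>. (v x - \<phi> x)\<^sup>2) + (LINT x|lebesgue_on \<Omega>. (norm (g x - grad \<phi> x))\<^sup>2) < \<epsilon>)"
proof -
  define N where "N \<phi> = (LINT x|lebesgue_on \<Omega>. (v x - \<phi> x)\<^sup>2) + (LINT x|lebesgue_on \<Omega>. (norm (g x - grad \<phi> x))\<^sup>2)" for \<phi>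
  have N: "H1_norm \<Omega> (\<lambda>x. v x - \<phi> x) = sqrt (N \<phi>)" if \<phi>: "\<phi> \<in> Cc_infty \<Omega>" for \<phi>
    unfolding N_def
    using H1_norm_eq[OF assms(1) L2_add_cmult[OF assms(3) grad_test_L2[OF assms(1) \<phi>], of "-1"]
        has_weak_gradient_add_cmult[OF assms(1,4) test_has_weak_gradient[OF assms(1) \<phi>], of "-1"]] by simp
  have N0: "0 \<le> N \<phi>" for \<phi> unfolding N_def by (intro add_nonneg_nonneg integral_nonneg_AE) auto
  have H1: "v \<in> H1 \<Omega>" using assms H1I by blast
  show ?thesis
  proof
    assume v: "v \<in> H10 \<Omega>"
    show "\<forall>\<epsilon>>0. \<exists>\<phi>\<in>Cc_infty \<Omega>. (LINT x|lebesgue_on \<Omega>. (v x - \<phi> x)\<^sup>2) + (LINT x|lebesgue_on \<Omega>. (norm (g x - grad \<phi> x))\<^sup>2) < \<epsilon>"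
    proof (intro allI impI)
      fix \<epsilon> :: real assume "\<epsilon> > 0"
      then have "0 < sqrt \<epsilon>" by simp
      then obtain \<phi> where "\<phi> \<in> Cc_infty \<Omega>" "H1_norm \<Omega> (\<lambda>x. v x - \<phi> x) < sqrt \<epsilon>"
        using v unfolding H10_def by blast
      then show "\<exists>\<phi>\<in>Cc_infty \<Omega>. (LINT x|lebesgue_on \<Omega>. (v x - \<phi> x)\<^sup>2) + (LINT x|lebesgue_on \<Omega>. (norm (g x - grad \<phi> x))\<^sup>2) < \<epsilon>"
        using N unfolding N_def[symmetric] by auto
    qed
  next
    assume a: "\<forall>\<epsilon>>0. \<exists>\<phi>\<in>Cc_infty \<Omega>. (LINT x|lebesgue_on \<Omega>. (v x - \<phi> x)\<^sup>2) + (LINT x|lebesgue_on \<Omega>. (norm (g x - grad \<phi> x))\<^sup>2) < \<epsilon>"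
    show "v \<in> H10 \<Omega>"
      unfolding H10_def
    proof (intro CollectI conjI allI impI H1)
      fix \<epsilon> :: real assume e: "\<epsilon> > 0"
      then obtain \<phi> where "\<phi> \<in> Cc_infty \<Omega>" "N \<phi> < \<epsilon>\<^sup>2"
        using a[rule_format, of "\<epsilon>\<^sup>2"] unfolding N_def[symmetric] by auto
      then show "\<exists>\<phi>\<in>Cc_infty \<Omega>. H1_norm \<Omega> (\<lambda>x. v x - \<phi> x) < \<epsilon>"
        using N e N0 by (intro bexI[of _ \<phi>]) (auto simp: real_less_lsqrt)
    qed
  qed
qed

section \<open>The weak gradient of the positive part\<close>

lemma Young_ineq: "0 < \<kappa> \<Longrightarrow> \<bar>a * b\<bar> \<le> \<kappa> * a\<^sup>2 + (1/\<kappa>) * (b::real)\<^sup>2"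
proof -
  assume k: "0 < \<kappa>"
  have "2 * (sqrt \<kappa> * \<bar>a\<bar>) * (\<bar>b\<bar> / sqrt \<kappa>) \<le> (sqrt \<kappa> * \<bar>a\<bar>)\<^sup>2 + (\<bar>b\<bar> / sqrt \<kappa>)\<^sup>2"
    by (rule sum_squares_bound)
  then have "2 * \<bar>a * b\<bar> \<le> \<kappa> * a\<^sup>2 + (1/\<kappa>) * b\<^sup>2"
    using k by (simp add: power_mult_distrib power_divide abs_mult)
  then show ?thesis using abs_ge_zero[of "a * b"] by linarith
qed

lemma integral_mult_Young:
  fixes f g :: "'a::euclidean_space \<Rightarrow> real"
  assumes "f \<in> L2 \<Omega>" "g \<in> L2 \<Omega>" "0 < \<kappa>"
  shows "(LINT x|lebesgue_on \<Omega>. \<bar>f x * g x\<bar>)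
    \<le> \<kappa> * (LINT x|lebesgue_on \<Omega>. (f x)\<^sup>2) + (1/\<kappa>) * (LINT x|lebesgue_on \<Omega>. (g x)\<^sup>2)"
proof -
  have i: "integrable (lebesgue_on \<Omega>) (\<lambda>x. (f x)\<^sup>2)" "integrable (lebesgue_on \<Omega>) (\<lambda>x. (g x)\<^sup>2)"
    using L2_integrable_square[OF assms(1)] L2_integrable_square[OF assms(2)] by simp_all
  have "(LINT x|lebesgue_on \<Omega>. \<bar>f x * g x\<bar>) \<le> (LINT x|lebesgue_on \<Omega>. \<kappa> * (f x)\<^sup>2 + (1/\<kappa>) * (g x)\<^sup>2)"
  proof (rule integral_mono)
    show "integrable (lebesgue_on \<Omega>) (\<lambda>x. \<bar>f x * g x\<bar>)"
      using L2_mult_integrable[OF assms(1,2)] by simp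
    show "integrable (lebesgue_on \<Omega>) (\<lambda>x. \<kappa> * (f x)\<^sup>2 + (1/\<kappa>) * (g x)\<^sup>2)"
      using i by simp
  qed (rule Young_ineq[OF assms(3)])
  also have "\<dots> = \<kappa> * (LINT x|lebesgue_on \<Omega>. (f x)\<^sup>2) + (1/\<kappa>) * (LINT x|lebesgue_on \<Omega>. (g x)\<^sup>2)"
    using i by simp
  finally show ?thesis .
qed

lemma L1loc_UNIV_measurable:
  fixes f :: "'a::euclidean_space \<Rightarrow> real"
  assumes "f \<in> L1loc UNIV" shows "f \<in> borel_measurable lebesgue"
proof (rule borel_measurable_LIMSEQ_real[where u="\<lambda>n x. indicator (cball 0 (real n)) x * f x"])
  show "(\<lambda>x. indicator (cball 0 (real n)) x * f x) \<in> borel_measurable lebesgue" for n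
    using assms by (intro borel_measurable_integrable) (auto simp: L1loc_def set_integrable_def)
  show "(\<lambda>n. indicator (cball 0 (real n)) x * f x) \<longlonglongrightarrow> f x" for x
  proof (rule tendsto_eventually)
    obtain N where "norm x \<le> real N" using real_arch_simple by blast
    then show "\<forall>\<^sub>F n in sequentially. indicator (cball 0 (real n)) x * f x = f x"
      by (intro eventually_sequentiallyI[of N]) (auto simp: indicator_def)
  qed
qed

lemma bounded_convergence_compact_support:
  fixes f \<psi> :: "'a::euclidean_space \<Rightarrow> real"
  assumes f: "f \<in> L1loc UNIV" and L: "compact L"
    and s: "\<And>n. s n \<in> borel_measurable lebesgue" "\<And>n x. \<bar>s n x\<bar> \<le> B" "\<And>n x. x \<notin> L \<Longrightarrow> s n x = 0"
    and \<psi>: "\<psi> \<in> borel_measurable lebesgue" "AE x in lebesgue. (\<lambda>n. s n x) \<longlonglongrightarrow> \<psi> x"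
  shows "(\<lambda>n. LINT x|lebesgue. f x * s n x) \<longlonglongrightarrow> (LINT x|lebesgue. f x * \<psi> x)"
proof -
  define F where "F x = indicator L x * f x" for x
  have F: "integrable lebesgue F"
    using f L by (auto simp: L1loc_def set_integrable_def F_def[abs_def])
  note Fm[measurable] = borel_measurable_integrable[OF F]
  note s(1)[measurable] \<psi>(1)[measurable]
  have eq: "f x * s n x = F x * s n x" for n x
    using s(3)[of x n] by (cases "x \<in> L") (auto simp: F_def)
  have eq\<psi>: "AE x in lebesgue. F x * \<psi> x = f x * \<psi> x"
    using \<psi>(2)
  proof eventually_elim
    case (elim x)
    show ?case
    proof (cases "x \<in> L")
      case False
      then have "\<psi> x = 0" using elim s(3)[OF False] by (simp add: LIMSEQ_const_iff)
      then show ?thesis by simp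
    qed (simp add: F_def)
  qed
  have "(\<lambda>n. LINT x|lebesgue. F x * s n x) \<longlonglongrightarrow> (LINT x|lebesgue. F x * \<psi> x)"
  proof (rule integral_dominated_convergence[where w="\<lambda>x. B * \<bar>F x\<bar>"])
    show "AE x in lebesgue. (\<lambda>n. F x * s n x) \<longlonglongrightarrow> F x * \<psi> x"
      using \<psi>(2) by eventually_elim (rule tendsto_mult_left)
    show "AE x in lebesgue. norm (F x * s n x) \<le> B * \<bar>F x\<bar>" for n
      using mult_right_mono[OF s(2)[of n] abs_ge_zero[of "F _"]] by (simp add: abs_mult mult.commute)
  qed (use F in auto)
  moreover have "(\<lambda>x. f x * \<psi> x) \<in> borel_measurable lebesgue"
    by (rule borel_measurable_AE[OF _ eq\<psi>]) simp
  then have "(LINT x|lebesgue. F x * \<psi> x) = (LINT x|lebesgue. f x * \<psi> x)"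
    using eq\<psi> by (intro integral_cong_AE) auto
  ultimately show ?thesis by (simp add: eq)
qed

lemma AE_lebesgue_shift:
  fixes a :: "'a::euclidean_space"
  assumes "AE x in lebesgue. P x" shows "AE x in lebesgue. P (x - a)"
  by (rule AE_distrD[OF measurable_lebesgue_shift]) (subst distr_lebesgue_shift, rule assms)

lemma notin_translate:
  fixes a :: "'a::group_add"
  shows "x \<notin> (\<lambda>x. x + a) ` K \<Longrightarrow> x - a \<notin> K"
  by (metis diff_add_cancel image_eqI)

lemma frechet_derivative_shift:
  assumes "(f has_derivative f') (at (x - a))"
  shows "frechet_derivative (\<lambda>x. f (x - a)) (at x) = f'"
proof -
  have "((\<lambda>x. x - a) has_derivative (\<lambda>h. h)) (at x)"
    by (auto intro!: derivative_eq_intros)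
  from has_derivative_compose[OF this assms] show ?thesis
    using frechet_derivative_at by metis
qed

lemma DERIV_integral_shift_test:
  assumes "u \<in> L1loc UNIV" "\<phi> \<in> Cc_infty \<Omega>" "i \<in> Basis"
  shows "((\<lambda>t. LINT x|lebesgue. u x * \<phi> (x - t *\<^sub>R i)) has_real_derivative
      - (LINT x|lebesgue. u x * frechet_derivative \<phi> (at (x - t *\<^sub>R i)) i)) (at t)"
proof -
  obtain K where K: "compact K" "K \<subseteq> \<Omega>" "\<And>x. x \<notin> K \<Longrightarrow> \<phi> x = 0"
      "\<And>x h. x \<notin> K \<Longrightarrow> frechet_derivative \<phi> (at x) h = 0"
    using Cc_inftyE[OF assms(2)] by metis
  show ?thesis
    by (rule DERIV_integral_shift[OF assms(1) Cc_infty_continuous[OF assms(2)]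
        Cc_infty_continuous_deriv[OF assms(2,3)] K(1,3,4)
        directional_derivative[OF Cc_infty_has_derivative[OF assms(2)]]])
qed

context
  fixes \<Omega> :: "'a::euclidean_space set" and u g :: "'a \<Rightarrow> real" and i :: 'a
  assumes open_\<Omega>: "open \<Omega>" and i: "i \<in> Basis"
    and u: "u \<in> L1loc UNIV" and g: "g \<in> L2 UNIV"
    and weak: "\<And>\<phi>. \<phi> \<in> Cc_infty \<Omega> \<Longrightarrow>
      (LINT x|lebesgue. u x * frechet_derivative \<phi> (at x) i) = - (LINT x|lebesgue. g x * \<phi> x)"
begin

text \<open>
  Let \<open>u\<close> have the weak derivative \<open>g\<close> in the direction \<open>i\<close> on \<open>\<Omega>\<close>, both functions being defined on
  the whole space. The difference quotients of \<open>u\<close> are bounded in \<open>L\<^sup>2\<close> by the weak derivative \<open>g\<close>. The bound is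
  stated by duality, with Young's inequality in place of the Cauchy-Schwarz inequality.
\<close>
lemma test_shift_bound:
  assumes \<phi>: "\<phi> \<in> Cc_infty \<Omega>" and L: "compact L" "\<And>x. x \<notin> L \<Longrightarrow> \<phi> x = 0"
    and d: "(\<Union>x\<in>L. cball x d) \<subseteq> \<Omega>" and h: "\<bar>h\<bar> \<le> d" and \<kappa>: "0 < \<kappa>"
  shows "\<bar>(LINT x|lebesgue. u x * \<phi> (x - h *\<^sub>R i)) - (LINT x|lebesgue. u x * \<phi> x)\<bar>
    \<le> \<bar>h\<bar> * (\<kappa> * (LINT x|lebesgue. (g x)\<^sup>2) + (1/\<kappa>) * (LINT x|lebesgue. (\<phi> x)\<^sup>2))"
proof -
  define A where "A t = (LINT x|lebesgue. u x * \<phi> (x - t *\<^sub>R i))" for t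
  define D where "D t = (LINT x|lebesgue. g x * \<phi> (x - t *\<^sub>R i))" for t
  have shift: "(\<lambda>x. \<phi> (x - t *\<^sub>R i)) \<in> Cc_infty \<Omega>" if "\<bar>t\<bar> \<le> d" for t
  proof (rule Cc_inftyI[of _ "(\<lambda>x. x + t *\<^sub>R i) ` L"])
    show "Ck k (\<lambda>x. \<phi> (x - t *\<^sub>R i))" for k by (rule Ck_shift[OF Cc_infty_smooth[OF \<phi>]])
    show "compact ((\<lambda>x. x + t *\<^sub>R i) ` L)"
      by (intro compact_continuous_image L continuous_intros)
    have "x + t *\<^sub>R i \<in> cball x d" for x using that i by (simp add: dist_norm)
    then show "(\<lambda>x. x + t *\<^sub>R i) ` L \<subseteq> \<Omega>" using d by blast
    show "\<phi> (x - t *\<^sub>R i) = 0" if "x \<notin> (\<lambda>x. x + t *\<^sub>R i) ` L" for x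
      by (rule L(2)[OF notin_translate[OF that]])
  qed
  have der: "(A has_real_derivative D t) (at t)" if "\<bar>t\<bar> \<le> d" for t
  proof -
    have "(A has_real_derivative - (LINT x|lebesgue. u x * frechet_derivative \<phi> (at (x - t *\<^sub>R i)) i)) (at t)"
      unfolding A_def by (rule DERIV_integral_shift_test[OF u \<phi> i])
    moreover have "(LINT x|lebesgue. u x * frechet_derivative \<phi> (at (x - t *\<^sub>R i)) i) = - D t"
      using weak[OF shift[OF that]] unfolding D_def
      by (simp add: frechet_derivative_shift[OF Cc_infty_has_derivative[OF \<phi>]])
    ultimately show ?thesis by simp
  qed
  have \<phi>m: "\<phi> \<in> borel_measurable lebesgue"
    by (rule continuous_imp_lebesgue_measurable[OF Cc_infty_continuous[OF \<phi>]])
  have Dbound: "\<bar>D t\<bar> \<le> \<kappa> * (LINT x|lebesgue. (g x)\<^sup>2) + (1/\<kappa>) * (LINT x|lebesgue. (\<phi> x)\<^sup>2)"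
    if "\<bar>t\<bar> \<le> d" for t
  proof -
    have "(\<lambda>x. \<phi> (x - t *\<^sub>R i)) \<in> Cc_infty UNIV"
      using shift[OF that] by (auto simp: Cc_infty_def)
    then have "(\<lambda>x. \<phi> (x - t *\<^sub>R i)) \<in> L2 UNIV" by (rule test_L2[OF open_UNIV])
    from integral_mult_Young[OF g this \<kappa>]
    have "(LINT x|lebesgue. \<bar>g x * \<phi> (x - t *\<^sub>R i)\<bar>)
        \<le> \<kappa> * (LINT x|lebesgue. (g x)\<^sup>2) + (1/\<kappa>) * (LINT x|lebesgue. (\<phi> (x - t *\<^sub>R i))\<^sup>2)"
      by (simp add: lebesgue_on_UNIV_eq)
    moreover have "\<bar>D t\<bar> \<le> (LINT x|lebesgue. \<bar>g x * \<phi> (x - t *\<^sub>R i)\<bar>)"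
      unfolding D_def by (rule integral_abs_bound)
    moreover have "(LINT x|lebesgue. (\<phi> (x - t *\<^sub>R i))\<^sup>2) = (LINT x|lebesgue. (\<phi> x)\<^sup>2)"
      using \<phi>m by (intro integral_lebesgue_shift[of "\<lambda>x. (\<phi> x)\<^sup>2"]) simp
    ultimately show ?thesis by simp
  qed
  have "\<exists>z. \<bar>z\<bar> \<le> d \<and> A h - A 0 = h * D z"
  proof (cases h "0::real" rule: linorder_cases)
    case less
    obtain z where "h < z" "z < 0" "A 0 - A h = (0 - h) * D z"
      using MVT2[OF less, of A D] der h by force
    then show ?thesis using h by (intro exI[of _ z]) auto
  next
    case greater
    obtain z where "0 < z" "z < h" "A h - A 0 = (h - 0) * D z"
      using MVT2[OF greater, of A D] der h by force
    then show ?thesis using h by (intro exI[of _ z]) auto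
  qed (use h in \<open>auto intro!: exI[of _ 0]\<close>)
  then obtain z where z: "\<bar>z\<bar> \<le> d" "A h - A 0 = h * D z" by blast
  have "\<bar>A h - A 0\<bar> = \<bar>h\<bar> * \<bar>D z\<bar>" by (simp add: z abs_mult)
  also have "\<dots> \<le> \<bar>h\<bar> * (\<kappa> * (LINT x|lebesgue. (g x)\<^sup>2) + (1/\<kappa>) * (LINT x|lebesgue. (\<phi> x)\<^sup>2))"
    by (rule mult_left_mono[OF Dbound[OF z(1)]]) simp
  finally show ?thesis by (simp add: A_def)
qed

lemma bounded_shift_bound:
  assumes K: "compact K" "K \<subseteq> \<Omega>"
  shows "\<exists>d>0. \<forall>\<psi> M h \<kappa>. \<psi> \<in> borel_measurable lebesgue \<and> (\<forall>x. \<bar>\<psi> x\<bar> \<le> M) \<and>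
    (\<forall>x. x \<notin> K \<longrightarrow> \<psi> x = 0) \<and> \<bar>h\<bar> \<le> d \<and> 0 < \<kappa> \<longrightarrow>
    \<bar>(LINT x|lebesgue. u x * \<psi> (x - h *\<^sub>R i)) - (LINT x|lebesgue. u x * \<psi> x)\<bar>
    \<le> \<bar>h\<bar> * (\<kappa> * (LINT x|lebesgue. (g x)\<^sup>2) + (1/\<kappa>) * (LINT x|lebesgue. (\<psi> x)\<^sup>2))"
proof -
  obtain L where L: "compact L" "L \<subseteq> \<Omega>" "K \<subseteq> L"
    "\<forall>\<psi> M. \<psi> \<in> borel_measurable lebesgue \<and> (\<forall>x. \<bar>\<psi> x\<bar> \<le> M) \<and> (\<forall>x. x \<notin> K \<longrightarrow> \<psi> x = 0) \<longrightarrow>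
      test_limit \<Omega> L \<psi>"
    using test_limit_exists[OF K(1) open_\<Omega> K(2)] by blast
  obtain d where d: "d > 0" "(\<Union>x\<in>L. cball x d) \<subseteq> \<Omega>"
    using compact_subset_open_imp_cball_epsilon_subset[OF L(1) open_\<Omega> L(2)] by metis
  show ?thesis
  proof (rule exI[of _ d], rule conjI[OF d(1)], intro allI impI, elim conjE)
    fix \<psi> :: "'a \<Rightarrow> real" and M h \<kappa> :: real
    assume \<psi>: "\<psi> \<in> borel_measurable lebesgue" "\<forall>x. \<bar>\<psi> x\<bar> \<le> M" "\<forall>x. x \<notin> K \<longrightarrow> \<psi> x = 0"
      and h: "\<bar>h\<bar> \<le> d" and \<kappa>: "0 < \<kappa>"
    have "test_limit \<Omega> L \<psi>" using L(4) \<psi> by blast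
    then obtain \<phi> B where \<phi>: "\<And>n. \<phi> n \<in> Cc_infty \<Omega>" "\<And>n x. \<bar>\<phi> n x\<bar> \<le> B"
        "\<And>n x. x \<notin> L \<Longrightarrow> \<phi> n x = 0" "AE x in lebesgue. (\<lambda>n. \<phi> n x) \<longlonglongrightarrow> \<psi> x"
      unfolding test_limit_def by blast
    have \<phi>m: "\<phi> n \<in> borel_measurable lebesgue" for n
      using continuous_imp_lebesgue_measurable[OF Cc_infty_continuous[OF \<phi>(1)]] .
    have 1: "(\<lambda>n. LINT x|lebesgue. u x * \<phi> n x) \<longlonglongrightarrow> (LINT x|lebesgue. u x * \<psi> x)"
      by (rule bounded_convergence_compact_support[OF u L(1) \<phi>m \<phi>(2,3) \<psi>(1) \<phi>(4)])
    have 2: "(\<lambda>n. LINT x|lebesgue. u x * \<phi> n (x - h *\<^sub>R i)) \<longlonglongrightarrow> (LINT x|lebesgue. u x * \<psi> (x - h *\<^sub>R i))"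
    proof (rule bounded_convergence_compact_support[OF u])
      show "compact ((\<lambda>x. x + h *\<^sub>R i) ` L)"
        by (intro compact_continuous_image L continuous_intros)
      show "\<phi> n (x - h *\<^sub>R i) = 0" if "x \<notin> (\<lambda>x. x + h *\<^sub>R i) ` L" for n x
        by (rule \<phi>(3)[OF notin_translate[OF that]])
      show "AE x in lebesgue. (\<lambda>n. \<phi> n (x - h *\<^sub>R i)) \<longlonglongrightarrow> \<psi> (x - h *\<^sub>R i)"
        by (rule AE_lebesgue_shift[OF \<phi>(4)])
    qed (use \<phi>(2) measurable_compose_shift[OF \<phi>m] measurable_compose_shift[OF \<psi>(1)] in auto)
    have 3: "(\<lambda>n. LINT x|lebesgue. 1 * (\<phi> n x)\<^sup>2) \<longlonglongrightarrow> (LINT x|lebesgue. 1 * (\<psi> x)\<^sup>2)"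
    proof (rule bounded_convergence_compact_support[OF const_L1loc L(1)])
      show "\<bar>(\<phi> n x)\<^sup>2\<bar> \<le> B\<^sup>2" for n x
        using power_mono[OF \<phi>(2)[of n x] abs_ge_zero, of 2] by simp
      show "AE x in lebesgue. (\<lambda>n. (\<phi> n x)\<^sup>2) \<longlonglongrightarrow> (\<psi> x)\<^sup>2"
        using \<phi>(4) by eventually_elim (rule tendsto_power)
    qed (use \<phi>m \<phi>(3) \<psi>(1) in auto)
    show "\<bar>(LINT x|lebesgue. u x * \<psi> (x - h *\<^sub>R i)) - (LINT x|lebesgue. u x * \<psi> x)\<bar>
      \<le> \<bar>h\<bar> * (\<kappa> * (LINT x|lebesgue. (g x)\<^sup>2) + (1/\<kappa>) * (LINT x|lebesgue. (\<psi> x)\<^sup>2))"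
    proof (rule LIMSEQ_le)
      show "(\<lambda>n. \<bar>(LINT x|lebesgue. u x * \<phi> n (x - h *\<^sub>R i)) - (LINT x|lebesgue. u x * \<phi> n x)\<bar>)
          \<longlonglongrightarrow> \<bar>(LINT x|lebesgue. u x * \<psi> (x - h *\<^sub>R i)) - (LINT x|lebesgue. u x * \<psi> x)\<bar>"
        by (intro tendsto_intros 1 2)
      show "(\<lambda>n. \<bar>h\<bar> * (\<kappa> * (LINT x|lebesgue. (g x)\<^sup>2) + (1/\<kappa>) * (LINT x|lebesgue. (\<phi> n x)\<^sup>2)))
          \<longlonglongrightarrow> \<bar>h\<bar> * (\<kappa> * (LINT x|lebesgue. (g x)\<^sup>2) + (1/\<kappa>) * (LINT x|lebesgue. (\<psi> x)\<^sup>2))"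
        using 3 by (intro tendsto_intros) simp
      show "\<exists>N. \<forall>n\<ge>N. \<bar>(LINT x|lebesgue. u x * \<phi> n (x - h *\<^sub>R i)) - (LINT x|lebesgue. u x * \<phi> n x)\<bar>
          \<le> \<bar>h\<bar> * (\<kappa> * (LINT x|lebesgue. (g x)\<^sup>2) + (1/\<kappa>) * (LINT x|lebesgue. (\<phi> n x)\<^sup>2))"
        using test_shift_bound[OF \<phi>(1) L(1) \<phi>(3) d(2) h \<kappa>] by blast
    qed
  qed
qed

text \<open>
  The difference quotients of \<open>u\<close> converge to \<open>g\<close> weakly against bounded measurable functions with
  compact support: for test functions this is the definition of the weak derivative, and the
  uniform bound carries it over to limits of test functions.
\<close>
lemma DERIV_integral_shift_bounded:
  assumes K: "compact K" "K \<subseteq> \<Omega>"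
    and \<psi>: "\<psi> \<in> borel_measurable lebesgue" "\<And>x. \<bar>\<psi> x\<bar> \<le> M" "\<And>x. x \<notin> K \<Longrightarrow> \<psi> x = 0"
  shows "((\<lambda>h. LINT x|lebesgue. u x * \<psi> (x - h *\<^sub>R i)) has_real_derivative
    (LINT x|lebesgue. g x * \<psi> x)) (at 0)"
proof -
  obtain L where L: "compact L" "L \<subseteq> \<Omega>" "K \<subseteq> L"
    "\<forall>\<psi> M. \<psi> \<in> borel_measurable lebesgue \<and> (\<forall>x. \<bar>\<psi> x\<bar> \<le> M) \<and> (\<forall>x. x \<notin> K \<longrightarrow> \<psi> x = 0) \<longrightarrow>
      test_limit \<Omega> L \<psi>"
    using test_limit_exists[OF K(1) open_\<Omega> K(2)] by blast
  have "test_limit \<Omega> L \<psi>" using L(4) \<psi> by blast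
  then obtain \<phi> B where \<phi>: "\<And>n. \<phi> n \<in> Cc_infty \<Omega>" "\<And>n x. \<bar>\<phi> n x\<bar> \<le> B"
      "\<And>n x. x \<notin> L \<Longrightarrow> \<phi> n x = 0" "AE x in lebesgue. (\<lambda>n. \<phi> n x) \<longlonglongrightarrow> \<psi> x"
    unfolding test_limit_def by blast
  have \<phi>m: "\<phi> n \<in> borel_measurable lebesgue" for n
    using continuous_imp_lebesgue_measurable[OF Cc_infty_continuous[OF \<phi>(1)]] .
  obtain d where d: "d > 0" and bound: "\<forall>\<psi> M h \<kappa>. \<psi> \<in> borel_measurable lebesgue \<and> (\<forall>x. \<bar>\<psi> x\<bar> \<le> M) \<and>
    (\<forall>x. x \<notin> L \<longrightarrow> \<psi> x = 0) \<and> \<bar>h\<bar> \<le> d \<and> 0 < \<kappa> \<longrightarrow>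
    \<bar>(LINT x|lebesgue. u x * \<psi> (x - h *\<^sub>R i)) - (LINT x|lebesgue. u x * \<psi> x)\<bar>
    \<le> \<bar>h\<bar> * (\<kappa> * (LINT x|lebesgue. (g x)\<^sup>2) + (1/\<kappa>) * (LINT x|lebesgue. (\<psi> x)\<^sup>2))"
    using bounded_shift_bound[OF L(1,2)] by blast
  define A where "A f h = (LINT x|lebesgue. u x * f (x - h *\<^sub>R i))" for f h
  define D where "D f = (LINT x|lebesgue. g x * f x)" for f
  have gL: "g \<in> L1loc UNIV" by (rule L2_imp_L1loc[OF open_UNIV g])
  have \<psi>L: "\<psi> x = 0" if "x \<notin> L" for x using that L(3) \<psi>(3) by blast
  have int: "integrable lebesgue (\<lambda>x. f x * s (x - h *\<^sub>R i))"
    if f: "f \<in> L1loc UNIV" and s: "s \<in> borel_measurable lebesgue" "\<And>x. \<bar>s x\<bar> \<le> C" "\<And>x. x \<notin> L \<Longrightarrow> s x = 0"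
    for f s :: "'a \<Rightarrow> real" and h C
  proof (rule L1loc_mult_integrable[OF f measurable_compose_shift[OF s(1)] s(2)])
    show "compact ((\<lambda>x. x + h *\<^sub>R i) ` L)"
      by (intro compact_continuous_image L continuous_intros)
    show "s (x - h *\<^sub>R i) = 0" if "x \<notin> (\<lambda>x. x + h *\<^sub>R i) ` L" for x
      by (rule s(3)[OF notin_translate[OF that]])
  qed simp
  have A_diff: "A (\<lambda>x. \<psi> x - \<phi> n x) h = A \<psi> h - A (\<phi> n) h" for n h
    unfolding A_def
    using int[OF u \<psi>(1,2) \<psi>L, of h] int[OF u \<phi>m \<phi>(2,3), of n h]
    by (simp add: right_diff_distrib)
  have D_lim: "(\<lambda>n. D (\<phi> n)) \<longlonglongrightarrow> D \<psi>"
    unfolding D_def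
    by (rule bounded_convergence_compact_support[OF gL L(1) \<phi>m \<phi>(2,3) \<psi>(1) \<phi>(4)])
  have L2_lim: "(\<lambda>n. LINT x|lebesgue. 1 * (\<psi> x - \<phi> n x)\<^sup>2) \<longlonglongrightarrow> (LINT x|lebesgue. 1 * (\<psi> x - \<psi> x)\<^sup>2)"
  proof (rule bounded_convergence_compact_support[OF const_L1loc L(1)])
    show "\<bar>(\<psi> x - \<phi> n x)\<^sup>2\<bar> \<le> (M + B)\<^sup>2" for n x
    proof -
      have "\<bar>\<psi> x - \<phi> n x\<bar> \<le> M + B" using \<psi>(2)[of x] \<phi>(2)[of n x] by linarith
      from power_mono[OF this abs_ge_zero, of 2] show ?thesis by simp
    qed
    show "AE x in lebesgue. (\<lambda>n. (\<psi> x - \<phi> n x)\<^sup>2) \<longlonglongrightarrow> (\<psi> x - \<psi> x)\<^sup>2"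
      using \<phi>(4) by eventually_elim (intro tendsto_intros)
  qed (use \<phi>m \<phi>(3) \<psi> \<psi>L in auto)
  have test: "(A (\<phi> n) has_real_derivative D (\<phi> n)) (at 0)" for n
    using DERIV_integral_shift_test[OF u \<phi>(1) i, of n 0] weak[OF \<phi>(1)[of n]]
    by (simp add: A_def[abs_def] D_def)
  have "((\<lambda>h. (A \<psi> (0 + h) - A \<psi> 0) / h) \<longlongrightarrow> D \<psi>) (at 0)"
  proof (rule LIM_I)
    fix r :: real assume r: "0 < r"
    \<comment> \<open>The weight in Young's inequality is chosen first, so that the term with \<open>g\<close> is small; then
      the test function is taken close enough to \<open>\<psi>\<close> for the other term.\<close>
    define I where "I = (LINT x|lebesgue. (g x)\<^sup>2)"
    have I: "0 \<le> I" unfolding I_def by (rule integral_nonneg_AE) simp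
    define \<kappa> where "\<kappa> = r / (4 * (I + 1))"
    have \<kappa>: "0 < \<kappa>" "\<kappa> * I < r / 4" using r I by (auto simp: \<kappa>_def field_simps)
    have "\<forall>\<^sub>F n in sequentially. \<bar>D (\<phi> n) - D \<psi>\<bar> < r / 4"
      using tendstoD[OF D_lim, of "r/4"] r by (simp add: dist_real_def)
    moreover have "\<forall>\<^sub>F n in sequentially. (LINT x|lebesgue. (\<psi> x - \<phi> n x)\<^sup>2) < \<kappa> * (r / 4)"
      using order_tendstoD(2)[OF L2_lim, of "\<kappa> * (r/4)"] r \<kappa> by simp
    ultimately have "\<forall>\<^sub>F n in sequentially. \<bar>D (\<phi> n) - D \<psi>\<bar> < r / 4 \<and>
        (LINT x|lebesgue. (\<psi> x - \<phi> n x)\<^sup>2) < \<kappa> * (r / 4)"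
      by eventually_elim simp
    then obtain n where n: "\<bar>D (\<phi> n) - D \<psi>\<bar> < r / 4" "(LINT x|lebesgue. (\<psi> x - \<phi> n x)\<^sup>2) < \<kappa> * (r / 4)"
      by (auto dest: eventually_happens)
    have "((\<lambda>h. (A (\<phi> n) (0 + h) - A (\<phi> n) 0) / h) \<longlongrightarrow> D (\<phi> n)) (at 0)"
      using test[of n] by (simp add: DERIV_def)
    from LIM_D[OF this, of "r/4"] obtain s where s: "s > 0" "\<And>h. h \<noteq> 0 \<Longrightarrow> \<bar>h\<bar> < s \<Longrightarrow>
        \<bar>(A (\<phi> n) (0 + h) - A (\<phi> n) 0) / h - D (\<phi> n)\<bar> < r / 4"
      using r unfolding real_norm_def diff_zero by auto
    show "\<exists>s>0. \<forall>h. h \<noteq> 0 \<and> norm (h - 0) < s \<longrightarrow> norm ((A \<psi> (0 + h) - A \<psi> 0) / h - D \<psi>) < r"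
    proof (intro exI[of _ "min s d"] conjI allI impI)
      show "min s d > 0" using s d by simp
      fix h :: real assume h: "h \<noteq> 0 \<and> norm (h - 0) < min s d"
      let ?f = "\<lambda>x. \<psi> x - \<phi> n x"
      have "?f \<in> borel_measurable lebesgue \<and> (\<forall>x. \<bar>?f x\<bar> \<le> M + B) \<and> (\<forall>x. x \<notin> L \<longrightarrow> ?f x = 0) \<and> \<bar>h\<bar> \<le> d \<and> 0 < \<kappa>"
      proof (intro conjI allI impI)
        show "?f \<in> borel_measurable lebesgue" using \<psi>(1) \<phi>m by (rule borel_measurable_diff)
        show "\<bar>?f x\<bar> \<le> M + B" for x using \<psi>(2)[of x] \<phi>(2)[of n x] by linarith
      qed (use \<phi>(3) \<psi>L h \<kappa> in auto)
      from bound[rule_format, OF this]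
      have "\<bar>A ?f h - A ?f 0\<bar> \<le> \<bar>h\<bar> * (\<kappa> * I + (1/\<kappa>) * (LINT x|lebesgue. (?f x)\<^sup>2))"
        by (simp add: A_def I_def)
      also have "\<dots> \<le> \<bar>h\<bar> * (r/4 + r/4)"
      proof (rule mult_left_mono)
        have "(1/\<kappa>) * (LINT x|lebesgue. (?f x)\<^sup>2) \<le> (1/\<kappa>) * (\<kappa> * (r/4))"
          using n(2) \<kappa>(1) by (intro mult_left_mono) auto
        moreover have cancel: "(1/\<kappa>) * (\<kappa> * (r/4)) = r/4" using \<kappa>(1) by simp
        ultimately show "\<kappa> * I + (1/\<kappa>) * (LINT x|lebesgue. (?f x)\<^sup>2) \<le> r/4 + r/4"
          using \<kappa>(2) unfolding cancel by linarith
      qed simp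
      finally have 1: "\<bar>(A ?f h - A ?f 0) / h\<bar> \<le> r/4 + r/4"
        using h by (simp add: field_simps)
      have 2: "\<bar>(A (\<phi> n) h - A (\<phi> n) 0) / h - D (\<phi> n)\<bar> < r / 4"
        using s(2)[of h] h by simp
      have "(A \<psi> h - A \<psi> 0) / h - D \<psi> = (A ?f h - A ?f 0) / h
          + ((A (\<phi> n) h - A (\<phi> n) 0) / h - D (\<phi> n)) + (D (\<phi> n) - D \<psi>)"
        by (simp add: A_diff diff_divide_distrib)
      then show "norm ((A \<psi> (0 + h) - A \<psi> 0) / h - D \<psi>) < r"
        using 1 2 n(1) unfolding real_norm_def add_0 by linarith
    qed
  qed
  then show ?thesis unfolding DERIV_def A_def D_def .
qed

text \<open>
  For \<open>\<phi> \<ge> 0\<close> and \<open>\<psi> = \<phi> \<cdot> 1\<^bsub>{u > 0}\<^esub>\<close>, convexity of the positive part, in the form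
  \<open>b\<^sup>+ - a\<^sup>+ \<ge> 1\<^bsub>{a > 0}\<^esub> (b - a)\<close>, says that
  \<open>h \<mapsto> \<integral> u\<^sup>+(x) \<phi>(x - h i) dx - \<integral> u(x) \<psi>(x - h i) dx\<close> is minimal at \<open>h = 0\<close>. Both
  terms are differentiable there, so that the derivatives agree.
\<close>
lemma pos_part_weak_derivative_nonneg:
  assumes \<phi>: "\<phi> \<in> Cc_infty \<Omega>" "\<And>x. 0 \<le> \<phi> x"
  shows "(LINT x|lebesgue. max 0 (u x) * frechet_derivative \<phi> (at x) i)
    = - (LINT x|lebesgue. g x * (if 0 < u x then \<phi> x else 0))"
proof -
  obtain K where K: "compact K" "K \<subseteq> \<Omega>" "\<And>x. x \<notin> K \<Longrightarrow> \<phi> x = 0"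
    using Cc_inftyE[OF \<phi>(1)] by metis
  obtain C where C: "\<And>x. \<bar>\<phi> x\<bar> \<le> C"
    using continuous_compact_support_bounded[OF Cc_infty_continuous[OF \<phi>(1)] K(1,3)] by blast
  have \<phi>m: "\<phi> \<in> borel_measurable lebesgue"
    by (rule continuous_imp_lebesgue_measurable[OF Cc_infty_continuous[OF \<phi>(1)]])
  define P where "P x = max 0 (u x)" for x
  define \<psi> where "\<psi> x = (if 0 < u x then \<phi> x else 0)" for x
  note um[measurable] = L1loc_UNIV_measurable[OF u]
  have PL: "P \<in> L1loc UNIV"
  proof -
    have "P = (\<lambda>x. (1/2) * u x + (1/2) * \<bar>u x\<bar>)" by (auto simp: P_def max_def)
    moreover have "(\<lambda>x. \<bar>u x\<bar>) \<in> L1loc UNIV"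
      using u set_integrable_abs by (auto simp: L1loc_def)
    ultimately show ?thesis
      using u by (auto simp: L1loc_def intro!: set_integral_add)
  qed
  have \<psi>m: "\<psi> \<in> borel_measurable lebesgue"
    unfolding \<psi>_def[abs_def] using \<phi>m by measurable
  have \<psi>b: "\<bar>\<psi> x\<bar> \<le> C" for x using C[of x] by (auto simp: \<psi>_def)
  have \<psi>0: "\<psi> x = 0" if "x \<notin> K" for x using K(3)[OF that] by (simp add: \<psi>_def)
  define B where "B h = (LINT x|lebesgue. P x * \<phi> (x - h *\<^sub>R i))" for h
  define A where "A h = (LINT x|lebesgue. u x * \<psi> (x - h *\<^sub>R i))" for h
  have shift: "(LINT x|lebesgue. f x * s (x - h *\<^sub>R i)) = (LINT x|lebesgue. f (x + h *\<^sub>R i) * s x)"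
      "integrable lebesgue (\<lambda>x. f (x + h *\<^sub>R i) * s x)"
    if f: "f \<in> L1loc UNIV" and s: "s \<in> borel_measurable lebesgue" "\<And>x. \<bar>s x\<bar> \<le> C" "\<And>x. x \<notin> K \<Longrightarrow> s x = 0"
    for f s :: "'a \<Rightarrow> real" and h
  proof -
    have "integrable lebesgue (\<lambda>x. f x * s (x - h *\<^sub>R i))"
    proof (rule L1loc_mult_integrable[OF f measurable_compose_shift[OF s(1)] s(2)])
      show "compact ((\<lambda>x. x + h *\<^sub>R i) ` K)"
        by (intro compact_continuous_image K continuous_intros)
      show "s (x - h *\<^sub>R i) = 0" if "x \<notin> (\<lambda>x. x + h *\<^sub>R i) ` K" for x
        by (rule s(3)[OF notin_translate[OF that]])
    qed simp
    from integrable_lebesgue_shift[OF this, of "- (h *\<^sub>R i)"]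
    show j: "integrable lebesgue (\<lambda>x. f (x + h *\<^sub>R i) * s x)" by simp
    show "(LINT x|lebesgue. f x * s (x - h *\<^sub>R i)) = (LINT x|lebesgue. f (x + h *\<^sub>R i) * s x)"
      using integral_lebesgue_shift[OF borel_measurable_integrable[OF j], of "h *\<^sub>R i"] by simp
  qed
  have "(B has_real_derivative - (LINT x|lebesgue. P x * frechet_derivative \<phi> (at x) i)) (at 0)"
    unfolding B_def using DERIV_integral_shift_test[OF PL \<phi>(1) i, of 0] by simp
  moreover have "(A has_real_derivative (LINT x|lebesgue. g x * \<psi> x)) (at 0)"
    unfolding A_def by (rule DERIV_integral_shift_bounded[OF K(1,2) \<psi>m \<psi>b \<psi>0])
  ultimately have deriv: "((\<lambda>h. B h - A h) has_real_derivative
      (- (LINT x|lebesgue. P x * frechet_derivative \<phi> (at x) i) - (LINT x|lebesgue. g x * \<psi> x))) (at 0)"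
    by (rule DERIV_diff)
  have min: "B 0 - A 0 \<le> B h - A h" for h
  proof -
    have int: "integrable lebesgue (\<lambda>x. P (x + h *\<^sub>R i) * \<phi> x)"
      "integrable lebesgue (\<lambda>x. u (x + h *\<^sub>R i) * \<psi> x)" for h
      by (rule shift(2)[OF PL \<phi>m C], erule K(3)) (rule shift(2)[OF u \<psi>m \<psi>b], erule \<psi>0)
    have "0 \<le> (LINT x|lebesgue. (P (x + h *\<^sub>R i) * \<phi> x - P (x + 0 *\<^sub>R i) * \<phi> x)
        - (u (x + h *\<^sub>R i) * \<psi> x - u (x + 0 *\<^sub>R i) * \<psi> x))"
    proof (rule integral_nonneg_AE, rule AE_I2)
      fix x
      have "0 \<le> (P (x + h *\<^sub>R i) - P x - (if 0 < u x then u (x + h *\<^sub>R i) - u x else 0)) * \<phi> x"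
        by (intro mult_nonneg_nonneg \<phi>(2)) (auto simp: P_def)
      then show "0 \<le> (P (x + h *\<^sub>R i) * \<phi> x - P (x + 0 *\<^sub>R i) * \<phi> x)
          - (u (x + h *\<^sub>R i) * \<psi> x - u (x + 0 *\<^sub>R i) * \<psi> x)"
        by (simp add: \<psi>_def left_diff_distrib split: if_splits)
    qed
    also have "\<dots> = (B h - B 0) - (A h - A 0)"
    proof -
      have "B t = (LINT x|lebesgue. P (x + t *\<^sub>R i) * \<phi> x)"
        "A t = (LINT x|lebesgue. u (x + t *\<^sub>R i) * \<psi> x)" for t
        unfolding B_def A_def
        by (rule shift(1)[OF PL \<phi>m C], erule K(3)) (rule shift(1)[OF u \<psi>m \<psi>b], erule \<psi>0)
      then show ?thesis using int[of h] int[of 0] by simp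
    qed
    finally show ?thesis by simp
  qed
  have "- (LINT x|lebesgue. P x * frechet_derivative \<phi> (at x) i) - (LINT x|lebesgue. g x * \<psi> x) = 0"
    using DERIV_local_min[OF deriv zero_less_one] min by blast
  then show ?thesis by (simp add: P_def \<psi>_def)
qed

end

lemma L2_extend_zero:
  fixes f :: "'a::euclidean_space \<Rightarrow> 'b::euclidean_space"
  assumes "open \<Omega>" "f \<in> L2 \<Omega>" shows "(\<lambda>x. if x \<in> \<Omega> then f x else 0) \<in> L2 UNIV"
proof -
  have \<Omega>: "\<Omega> \<in> sets lebesgue" using assms(1) by simp
  have "integrable lebesgue (\<lambda>x. if x \<in> \<Omega> then (norm (f x))\<^sup>2 else 0)"
    using L2_integrable_square[OF assms(2)] by (simp add: Lebesgue_Measure.integrable_restrict_UNIV[OF \<Omega>])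
  moreover have "(\<lambda>x. if x \<in> \<Omega> then (norm (f x))\<^sup>2 else 0) = (\<lambda>x. (norm (if x \<in> \<Omega> then f x else 0))\<^sup>2)"
    by auto
  ultimately show ?thesis
    using borel_measurable_if_I[OF L2_measurable[OF assms(2)] \<Omega>]
    by (simp add: L2_def lebesgue_on_UNIV_eq)
qed

lemma L2_restrict_superlevel:
  fixes u :: "'a::euclidean_space \<Rightarrow> real" and g :: "'a \<Rightarrow> 'b::euclidean_space"
  assumes "u \<in> borel_measurable (lebesgue_on \<Omega>)" "g \<in> L2 \<Omega>"
  shows "(\<lambda>x. if l < u x then g x else 0) \<in> L2 \<Omega>"
proof (rule L2_bound[OF _ L2_integrable_square[OF assms(2)]])
  show "(\<lambda>x. if l < u x then g x else 0) \<in> borel_measurable (lebesgue_on \<Omega>)"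
    using assms(1) L2_measurable[OF assms(2)] by measurable
qed auto

lemma pos_part_L2:
  assumes "u \<in> L2 \<Omega>" shows "pos_part u \<in> L2 \<Omega>"
proof (rule L2_bound[OF _ L2_integrable_square[OF assms]])
  show "pos_part u \<in> borel_measurable (lebesgue_on \<Omega>)"
    using L2_measurable[OF assms] unfolding pos_part_def by measurable
qed (auto simp: pos_part_def max_def)

lemma pos_part_has_weak_gradient:
  assumes \<Omega>: "open \<Omega>" and u: "u \<in> L2 \<Omega>" and g: "g \<in> L2 \<Omega>" and ug: "has_weak_gradient \<Omega> u g"
  shows "has_weak_gradient \<Omega> (pos_part u) (\<lambda>x. if 0 < u x then g x else 0)"
  unfolding has_weak_gradient_def
proof (intro conjI ballI)
  let ?g = "\<lambda>x. if 0 < u x then g x else 0"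
  show L: "pos_part u \<in> L1loc \<Omega>" "?g \<in> L1loc \<Omega>"
    using L2_imp_L1loc[OF \<Omega>] pos_part_L2[OF u] L2_restrict_superlevel[OF L2_measurable[OF u] g] by auto
  fix \<phi> i assume \<phi>: "\<phi> \<in> Cc_infty \<Omega>" and i: "i \<in> (Basis :: 'a set)"
  have Om: "\<Omega> \<in> sets lebesgue" using \<Omega> by simp
  \<comment> \<open>Extension by zero makes translations available.\<close>
  define u0 where "u0 x = (if x \<in> \<Omega> then u x else 0)" for x
  define g0 where "g0 x = (if x \<in> \<Omega> then g x \<bullet> i else 0)" for x
  have u0: "u0 \<in> L1loc UNIV"
    unfolding u0_def[abs_def] by (rule L2_imp_L1loc[OF open_UNIV L2_extend_zero[OF \<Omega> u]])
  have "(\<lambda>x. g x \<bullet> i) \<in> L2 \<Omega>"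
  proof (rule L2_bound[OF _ L2_integrable_square[OF g]])
    show "(\<lambda>x. g x \<bullet> i) \<in> borel_measurable (lebesgue_on \<Omega>)"
      using L2_measurable[OF g] by measurable
    show "AE x in lebesgue_on \<Omega>. (norm (g x \<bullet> i))\<^sup>2 \<le> (norm (g x))\<^sup>2"
      using Basis_le_norm[OF i] by (intro AE_I2 power_mono) auto
  qed
  then have g0: "g0 \<in> L2 UNIV"
    unfolding g0_def[abs_def] by (rule L2_extend_zero[OF \<Omega>])
  have restrict: "(LINT x|lebesgue_on \<Omega>. f x) = (LINT x|lebesgue. (if x \<in> \<Omega> then f x else 0))" for f :: "'a \<Rightarrow> real"
    by (rule Lebesgue_Measure.integral_restrict_UNIV[OF Om, symmetric])
  have weak0: "(LINT x|lebesgue. u0 x * frechet_derivative \<theta> (at x) i) = - (LINT x|lebesgue. g0 x * \<theta> x)"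
    if "\<theta> \<in> Cc_infty \<Omega>" for \<theta>
  proof -
    have "(LINT x|lebesgue_on \<Omega>. u x * frechet_derivative \<theta> (at x) i) = - (LINT x|lebesgue_on \<Omega>. (g x \<bullet> i) * \<theta> x)"
      using ug that i by (simp add: has_weak_gradient_def)
    then show ?thesis
      unfolding restrict u0_def g0_def by (simp add: if_distrib[of "\<lambda>y. y * _"] cong: if_cong)
  qed
  have nonneg: "(LINT x|lebesgue_on \<Omega>. pos_part u x * frechet_derivative \<theta> (at x) i)
      = - (LINT x|lebesgue_on \<Omega>. (?g x \<bullet> i) * \<theta> x)"
    if \<theta>: "\<theta> \<in> Cc_infty \<Omega>" "\<And>x. 0 \<le> \<theta> x" for \<theta>
  proof -
    have "(\<lambda>x. if x \<in> \<Omega> then pos_part u x * frechet_derivative \<theta> (at x) i else 0)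
        = (\<lambda>x. max 0 (u0 x) * frechet_derivative \<theta> (at x) i)"
      by (auto simp: pos_part_def u0_def)
    moreover have "(\<lambda>x. if x \<in> \<Omega> then (?g x \<bullet> i) * \<theta> x else 0)
        = (\<lambda>x. g0 x * (if 0 < u0 x then \<theta> x else 0))"
      by (auto simp: u0_def g0_def)
    ultimately show ?thesis
      unfolding restrict using pos_part_weak_derivative_nonneg[OF \<Omega> i u0 g0 weak0 \<theta>] by simp
  qed
  obtain K where K: "compact K" "K \<subseteq> \<Omega>" "\<And>x. x \<notin> K \<Longrightarrow> \<phi> x = 0"
    using Cc_inftyE[OF \<phi>] by metis
  obtain C where C: "0 < C" "\<And>x. \<bar>\<phi> x\<bar> \<le> C"
    using continuous_compact_support_bounded[OF Cc_infty_continuous[OF \<phi>] K(1,3)] by blast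
  obtain \<eta> where \<eta>: "\<eta> \<in> Cc_infty \<Omega>" "\<And>x. 0 \<le> \<eta> x" "\<And>x. x \<in> K \<Longrightarrow> 0 < \<eta> x"
    using cutoff_exists[OF K(1) \<Omega> K(2)] by metis
  have "\<exists>m>0. \<forall>x\<in>K. m \<le> \<eta> x"
    using Cc_infty_continuous[OF \<eta>(1)] \<eta>(3)
    by (intro continuous_pos_lower_bound[OF K(1)]) (auto elim: continuous_on_subset)
  then obtain m where m: "m > 0" "\<And>x. x \<in> K \<Longrightarrow> m \<le> \<eta> x" by blast
  \<comment> \<open>A test function with \<open>\<theta> \<ge> \<bar>\<phi>\<bar>\<close> writes \<open>\<phi>\<close> as the difference of the nonnegative test functions
    \<open>\<phi> + \<theta>\<close> and \<open>\<theta>\<close>.\<close>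
  define \<theta> where "\<theta> x = (C/m) * \<eta> x" for x
  have \<theta>: "\<theta> \<in> Cc_infty \<Omega>" "\<And>x. 0 \<le> \<theta> x"
    unfolding \<theta>_def[abs_def] using Cc_infty_cmult[OF \<eta>(1), of "C/m"] \<eta>(2) C(1) m(1) by simp_all
  have \<phi>\<theta>: "(\<lambda>x. \<phi> x + \<theta> x) \<in> Cc_infty \<Omega>" by (rule Cc_infty_add[OF \<phi> \<theta>(1)])
  have \<phi>\<theta>0: "0 \<le> \<phi> x + \<theta> x" for x
  proof (cases "x \<in> K")
    case True
    have "C = (C/m) * m" using m(1) by simp
    also have "\<dots> \<le> \<theta> x" unfolding \<theta>_def using C(1) m(1) m(2)[OF True] by (intro mult_left_mono) auto
    finally show ?thesis using C(2)[of x] by linarith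
  qed (use K(3) \<theta>(2) in auto)
  have d: "frechet_derivative (\<lambda>x. \<phi> x + \<theta> x) (at x) i = frechet_derivative \<phi> (at x) i + frechet_derivative \<theta> (at x) i" for x
    using frechet_derivative_at[OF has_derivative_add[OF Cc_infty_has_derivative[OF \<phi>] Cc_infty_has_derivative[OF \<theta>(1)]]]
    by metis
  note int = test_mult_integrable(2)[OF \<Omega> L(1) \<phi> i] test_mult_integrable(2)[OF \<Omega> L(1) \<theta>(1) i]
    test_mult_integrable(1)[OF \<Omega> L1loc_inner[OF L(2), of i] \<phi>]
    test_mult_integrable(1)[OF \<Omega> L1loc_inner[OF L(2), of i] \<theta>(1)]
  show "(LINT x|lebesgue_on \<Omega>. pos_part u x * frechet_derivative \<phi> (at x) i)
      = - (LINT x|lebesgue_on \<Omega>. (?g x \<bullet> i) * \<phi> x)"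
    using nonneg[OF \<phi>\<theta> \<phi>\<theta>0] nonneg[OF \<theta>] int
    by (simp only: d distrib_left Bochner_Integration.integral_add)
qed

section \<open>The space of functions with vanishing trace\<close>

lemma grad_cmult:
  assumes "\<phi> \<in> Cc_infty \<Omega>" shows "grad (\<lambda>x. a * \<phi> x) x = a *\<^sub>R grad \<phi> x"
proof -
  have "((\<lambda>x. a * \<phi> x) has_derivative (\<lambda>h. a * frechet_derivative \<phi> (at x) h)) (at x)"
    using Cc_infty_has_derivative[OF assms] by (rule has_derivative_mult_right)
  then have "frechet_derivative (\<lambda>x. a * \<phi> x) (at x) = (\<lambda>h. a * frechet_derivative \<phi> (at x) h)"
    by (metis frechet_derivative_at)
  then show ?thesis by (simp add: grad_def scaleR_sum_right)
qed

lemma H1_E: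
  assumes "open \<Omega>" "u \<in> H1 \<Omega>"
  shows "u \<in> L2 \<Omega>" "weak_gradient \<Omega> u \<in> L2 \<Omega>" "has_weak_gradient \<Omega> u (weak_gradient \<Omega> u)"
proof -
  obtain g where g: "u \<in> L2 \<Omega>" "g \<in> L2 \<Omega>" "has_weak_gradient \<Omega> u g"
    using assms(2) by (auto simp: H1_def)
  show "u \<in> L2 \<Omega>" by fact
  show "has_weak_gradient \<Omega> u (weak_gradient \<Omega> u)"
    unfolding weak_gradient_def by (rule someI[of "has_weak_gradient \<Omega> u", OF g(3)])
  show "weak_gradient \<Omega> u \<in> L2 \<Omega>"
  proof (rule L2_bound[OF weak_gradient_measurable[OF assms(1) g(3) L2_measurable[OF g(2)]] L2_integrable_square[OF g(2)]])
    show "AE x in lebesgue_on \<Omega>. (norm (weak_gradient \<Omega> u x))\<^sup>2 \<le> (norm (g x))\<^sup>2"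
      using weak_gradient_AE_eq[OF assms(1) g(3)] by eventually_elim simp
  qed
qed

lemma H10_uminus:
  assumes "open \<Omega>" "v \<in> H10 \<Omega>" shows "(\<lambda>x. - v x) \<in> H10 \<Omega>"
proof -
  have v: "v \<in> H1 \<Omega>" using assms(2) by (simp add: H10_def)
  note E = H1_E[OF assms(1) v]
  let ?g = "weak_gradient \<Omega> v"
  have 1: "(\<lambda>x. - v x) \<in> L2 \<Omega>" "(\<lambda>x. - ?g x) \<in> L2 \<Omega>"
    using E(1,2) by (auto simp: L2_def)
  have 2: "has_weak_gradient \<Omega> (\<lambda>x. - v x) (\<lambda>x. - ?g x)"
    using has_weak_gradient_add_cmult[OF assms(1) const_has_weak_gradient[OF assms(1), of 0] E(3), of "-1"] by simp
  show ?thesis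
    unfolding H10_iff[OF assms(1) 1 2]
  proof (intro allI impI)
    fix \<epsilon> :: real assume "\<epsilon> > 0"
    then obtain \<phi> where \<phi>: "\<phi> \<in> Cc_infty \<Omega>"
      "(LINT x|lebesgue_on \<Omega>. (v x - \<phi> x)\<^sup>2) + (LINT x|lebesgue_on \<Omega>. (norm (?g x - grad \<phi> x))\<^sup>2) < \<epsilon>"
      using assms(2) H10_iff[OF assms(1) E] by blast
    have "(- v x - (-1) * \<phi> x)\<^sup>2 = (v x - \<phi> x)\<^sup>2" for x by (simp add: power2_commute)
    moreover have "norm (- ?g x - grad (\<lambda>x. (-1) * \<phi> x) x) = norm (?g x - grad \<phi> x)" for x
      unfolding grad_cmult[OF \<phi>(1)] by (simp add: norm_minus_commute)
    ultimately show "\<exists>\<phi>\<in>Cc_infty \<Omega>. (LINT x|lebesgue_on \<Omega>. (- v x - \<phi> x)\<^sup>2) +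
        (LINT x|lebesgue_on \<Omega>. (norm (- ?g x - grad \<phi> x))\<^sup>2) < \<epsilon>"
      using \<phi> by (intro bexI[of _ "\<lambda>x. (-1) * \<phi> x"] Cc_infty_cmult) auto
  qed
qed

lemma zero_in_H10:
  assumes "open \<Omega>" shows "(\<lambda>x. 0) \<in> H10 \<Omega>"
proof -
  have z: "(\<lambda>x. 0) \<in> Cc_infty \<Omega>" by (rule Cc_inftyI[of _ "{}"]) (auto intro: Ck_const)
  have 1: "(\<lambda>x. 0 :: real) \<in> L2 \<Omega>" "(\<lambda>x. 0 :: 'a) \<in> L2 \<Omega>" by (auto simp: L2_def)
  show ?thesis
    unfolding H10_iff[OF assms 1 const_has_weak_gradient[OF assms]]
    by (intro allI impI bexI[OF _ z]) (simp add: grad_def)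
qed

lemma L2_sq_triangle:
  fixes f g h :: "'a::euclidean_space \<Rightarrow> 'b::euclidean_space"
  assumes "f \<in> L2 \<Omega>" "g \<in> L2 \<Omega>" "h \<in> L2 \<Omega>"
  shows "(LINT x|lebesgue_on \<Omega>. (norm (f x - h x))\<^sup>2)
    \<le> 2 * (LINT x|lebesgue_on \<Omega>. (norm (f x - g x))\<^sup>2) + 2 * (LINT x|lebesgue_on \<Omega>. (norm (g x - h x))\<^sup>2)"
proof -
  have i: "integrable (lebesgue_on \<Omega>) (\<lambda>x. (norm (p x - q x))\<^sup>2)"
    if "p \<in> L2 \<Omega>" "q \<in> L2 \<Omega>" for p q :: "'a \<Rightarrow> 'b"
    using L2_integrable_square[OF L2_add_cmult[OF that, of "-1"]] by simp
  have "(LINT x|lebesgue_on \<Omega>. (norm (f x - h x))\<^sup>2)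
      \<le> (LINT x|lebesgue_on \<Omega>. 2 * (norm (f x - g x))\<^sup>2 + 2 * (norm (g x - h x))\<^sup>2)"
  proof (rule integral_mono)
    show "(norm (f x - h x))\<^sup>2 \<le> 2 * (norm (f x - g x))\<^sup>2 + 2 * (norm (g x - h x))\<^sup>2" for x
      using norm_add_square_le[of "f x - g x" "g x - h x"] by simp
  qed (use i assms in auto)
  then show ?thesis using i assms by simp
qed

lemma H10_closed:
  assumes \<Omega>: "open \<Omega>" and v: "v \<in> L2 \<Omega>" "g \<in> L2 \<Omega>" "has_weak_gradient \<Omega> v g"
    and lim: "\<And>\<epsilon>. 0 < \<epsilon> \<Longrightarrow> \<exists>w h. w \<in> H10 \<Omega> \<and> w \<in> L2 \<Omega> \<and> h \<in> L2 \<Omega> \<and> has_weak_gradient \<Omega> w h \<and>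
      (LINT x|lebesgue_on \<Omega>. (v x - w x)\<^sup>2) + (LINT x|lebesgue_on \<Omega>. (norm (g x - h x))\<^sup>2) < \<epsilon>"
  shows "v \<in> H10 \<Omega>"
  unfolding H10_iff[OF \<Omega> v]
proof (intro allI impI)
  fix \<epsilon> :: real assume e: "\<epsilon> > 0"
  obtain w h where w: "w \<in> H10 \<Omega>" "w \<in> L2 \<Omega>" "h \<in> L2 \<Omega>" "has_weak_gradient \<Omega> w h"
    and 1: "(LINT x|lebesgue_on \<Omega>. (v x - w x)\<^sup>2) + (LINT x|lebesgue_on \<Omega>. (norm (g x - h x))\<^sup>2) < \<epsilon>/4"
    using lim[of "\<epsilon>/4"] e by auto
  have "0 < \<epsilon>/4" using e by simp
  then obtain \<phi> where \<phi>: "\<phi> \<in> Cc_infty \<Omega>"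
    and 2: "(LINT x|lebesgue_on \<Omega>. (w x - \<phi> x)\<^sup>2) + (LINT x|lebesgue_on \<Omega>. (norm (h x - grad \<phi> x))\<^sup>2) < \<epsilon>/4"
    using H10_iff[OF \<Omega> w(2-4)] w(1) by blast
  show "\<exists>\<phi>\<in>Cc_infty \<Omega>. (LINT x|lebesgue_on \<Omega>. (v x - \<phi> x)\<^sup>2) + (LINT x|lebesgue_on \<Omega>. (norm (g x - grad \<phi> x))\<^sup>2) < \<epsilon>"
    using L2_sq_triangle[OF v(1) w(2) test_L2[OF \<Omega> \<phi>]] L2_sq_triangle[OF v(2) w(3) grad_test_L2[OF \<Omega> \<phi>]] 1 2
    by (intro bexI[OF _ \<phi>]) simp
qed

lemma measure_lebesgue_bounded_open:
  fixes \<Omega> :: "'a::euclidean_space set"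
  assumes "open \<Omega>" "bounded \<Omega>"
  shows "integrable (lebesgue_on \<Omega>) (\<lambda>x. c::real)"
    and "(LINT x|lebesgue_on \<Omega>. c) = c * measure lebesgue \<Omega>"
    and "\<Omega> \<noteq> {} \<Longrightarrow> 0 < measure lebesgue \<Omega>"
proof -
  have lm: "\<Omega> \<in> lmeasurable" using assms by (simp add: lmeasurable_open)
  then show "integrable (lebesgue_on \<Omega>) (\<lambda>x. c)"
    using finite_measure.integrable_const finite_measure_lebesgue_on by blast
  show "(LINT x|lebesgue_on \<Omega>. c) = c * measure lebesgue \<Omega>"
    using lm by (simp add: measure_restrict_space fmeasurableD)
  show "0 < measure lebesgue \<Omega>" if "\<Omega> \<noteq> {}"
  proof -
    have "\<not> negligible \<Omega>" using open_not_negligible[OF assms(1) that] .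
    then show ?thesis using lm by (metis negligible_iff_measure0 zero_less_measure_iff)
  qed
qed

lemma DERIV_pos_part_square:
  "((\<lambda>t::real. (max 0 t)\<^sup>2) has_real_derivative 2 * max 0 t) (at t)"
proof (cases t "0::real" rule: linorder_cases)
  case less
  have "((\<lambda>_. 0) has_real_derivative 0) (at t)" by simp
  then have "((\<lambda>t::real. (max 0 t)\<^sup>2) has_real_derivative 0) (at t)"
    by (rule has_field_derivative_transform_within_open[where S="{..<0}"]) (use less in auto)
  then show ?thesis using less by simp
next
  case equal
  have "((\<lambda>h::real. (max 0 h)\<^sup>2 / h) \<longlongrightarrow> 0) (at 0)"
  proof (rule Lim_transform_eventually)
    show "((\<lambda>h::real. max 0 h) \<longlongrightarrow> 0) (at 0)"
    proof -
      have "((\<lambda>h::real. max 0 h) \<longlongrightarrow> max 0 0) (at 0)" by (intro tendsto_intros)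
      then show ?thesis by simp
    qed
    show "\<forall>\<^sub>F h::real in at 0. max 0 h = (max 0 h)\<^sup>2 / h"
      by (auto simp: eventually_at_filter power2_eq_square max_def)
  qed
  then show ?thesis using equal by (simp add: DERIV_def)
next
  case greater
  have "((\<lambda>t::real. t\<^sup>2) has_real_derivative 2 * t) (at t)"
    by (auto intro!: derivative_eq_intros)
  then have "((\<lambda>t::real. (max 0 t)\<^sup>2) has_real_derivative 2 * t) (at t)"
    by (rule has_field_derivative_transform_within_open[where S="{0<..}"]) (use greater in auto)
  then show ?thesis using greater by simp
qed

text \<open>
  A function bounded below by \<open>\<delta> > 0\<close> does not have vanishing trace. For test functions \<open>\<phi>\<close> near
  \<open>w\<close> put \<open>G(t) = 1 - (max 0 (1 - t/\<delta>))\<^sup>2\<close>. The integral over \<open>\<Omega>\<close> of the \<open>i\<close>-th partial derivative of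
  \<open>(x \<bullet> i) G(\<phi> x)\<close>, which is \<open>G(\<phi>) + (x \<bullet> i) G'(\<phi>) \<partial>\<^sub>i\<phi>\<close>, vanishes. Since \<open>w \<ge> \<delta>\<close>, both
  \<open>1 - G(\<phi>)\<close> and \<open>G'(\<phi>)\<close> are controlled by \<open>w - \<phi>\<close>, so that the measure of \<open>\<Omega>\<close> would vanish.
\<close>
lemma H10_not_bounded_below:
  fixes \<Omega> :: "'a::euclidean_space set"
  assumes \<Omega>: "open \<Omega>" "bounded \<Omega>" "\<Omega> \<noteq> {}"
    and w: "w \<in> H10 \<Omega>" and \<delta>: "0 < \<delta>" "\<And>x. x \<in> \<Omega> \<Longrightarrow> \<delta> \<le> w x"
  shows False
proof -
  have "w \<in> H1 \<Omega>" using w by (simp add: H10_def)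
  note E = H1_E[OF \<Omega>(1) this]
  define g where "g = weak_gradient \<Omega> w"
  note wg = E[folded g_def]
  define m where "m = measure lebesgue \<Omega>"
  have m: "0 < m" unfolding m_def by (rule measure_lebesgue_bounded_open(3)[OF \<Omega>])
  obtain R where R: "0 < R" "\<And>x. x \<in> \<Omega> \<Longrightarrow> norm x \<le> R"
    using \<Omega>(2) unfolding bounded_pos by blast
  obtain i :: 'a where i: "i \<in> Basis" using nonempty_Basis by blast
  define I where "I = (LINT x|lebesgue_on \<Omega>. (norm (g x))\<^sup>2)"
  have I: "0 \<le> I" unfolding I_def by (rule integral_nonneg_AE) simp
  define T where "T = 2 * R / \<delta>\<^sup>2"
  have T: "0 < T" unfolding T_def using R \<delta> by simp
  \<comment> \<open>The weight \<open>\<kappa>\<close> in Young's inequality makes the contribution of \<open>g\<close> at most \<open>m/4\<close>; then \<open>\<phi>\<close> is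
    chosen so close to \<open>w\<close> that the remaining terms stay below \<open>m/2\<close>.\<close>
  define \<kappa> where "\<kappa> = m / (4 * T * (I + 1))"
  have \<kappa>: "0 < \<kappa>" unfolding \<kappa>_def using m T I by simp
  have \<kappa>I: "T * \<kappa> * I \<le> m / 4"
  proof -
    have "T * \<kappa> = m / (4 * (I + 1))" unfolding \<kappa>_def using T by simp
    then have "T * \<kappa> * I = (m / 4) * (I / (I + 1))" by simp
    also have "\<dots> \<le> (m / 4) * 1" using m I by (intro mult_left_mono) auto
    finally show ?thesis by simp
  qed
  define Q where "Q = 1 / \<delta>\<^sup>2 + T * (1 / \<kappa> + 1)"
  have Q: "0 < Q" unfolding Q_def using \<delta> T \<kappa> by (intro add_pos_pos mult_pos_pos) auto
  have "0 < m / (2 * Q)" using m Q by simp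
  then obtain \<phi> where \<phi>: "\<phi> \<in> Cc_infty \<Omega>"
    and N: "(LINT x|lebesgue_on \<Omega>. (w x - \<phi> x)\<^sup>2) + (LINT x|lebesgue_on \<Omega>. (norm (g x - grad \<phi> x))\<^sup>2) < m / (2 * Q)"
    using w H10_iff[OF \<Omega>(1) wg] by blast
  define N1 where "N1 = (LINT x|lebesgue_on \<Omega>. (w x - \<phi> x)\<^sup>2)"
  define N2 where "N2 = (LINT x|lebesgue_on \<Omega>. (norm (g x - grad \<phi> x))\<^sup>2)"
  have N12: "0 \<le> N1" "0 \<le> N2" unfolding N1_def N2_def by (auto intro!: integral_nonneg_AE)
  obtain K where K: "compact K" "K \<subseteq> \<Omega>" "\<And>x. x \<notin> K \<Longrightarrow> \<phi> x = 0"
      "\<And>x h. x \<notin> K \<Longrightarrow> frechet_derivative \<phi> (at x) h = 0"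
    using Cc_inftyE[OF \<phi>] by metis
  define p where "p x = max 0 (1 - \<phi> x / \<delta>)" for x
  define f where "f x = (x \<bullet> i) * (1 - (p x)\<^sup>2)" for x
  define f' where "f' x = (1 - (p x)\<^sup>2) + (x \<bullet> i) * (2 * p x * (frechet_derivative \<phi> (at x) i / \<delta>))" for x
  note cont = Cc_infty_continuous[OF \<phi>] Cc_infty_continuous_deriv[OF \<phi> i]
  have pc: "continuous_on UNIV p"
    unfolding p_def using cont(1) \<delta>(1) by (intro continuous_intros) auto
  have fc: "continuous_on UNIV f" "continuous_on UNIV f'"
    unfolding f_def f'_def using pc cont(2) \<delta>(1) by (intro continuous_intros; auto)+
  have f0: "f x = 0" "f' x = 0" if "x \<notin> K" for x
    using K(3,4)[OF that] by (auto simp: f_def f'_def p_def)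
  have "(LINT x|lebesgue. f' x) = 0"
  proof (rule integral_deriv_eq_0[OF fc K(1) f0, of i])
    fix x
    have d\<phi>: "((\<lambda>t. \<phi> (x + t *\<^sub>R i)) has_real_derivative frechet_derivative \<phi> (at x) i) (at 0)"
      by (rule directional_derivative[OF Cc_infty_has_derivative[OF \<phi>]])
    have "((\<lambda>t. 1 - \<phi> (x + t *\<^sub>R i) / \<delta>) has_real_derivative - (frechet_derivative \<phi> (at x) i / \<delta>)) (at 0)"
      using DERIV_diff[OF DERIV_const[of 1] DERIV_cdivide[OF d\<phi>, of \<delta>]] by simp
    from DERIV_chain2[OF DERIV_pos_part_square this]
    have "((\<lambda>t. (p (x + t *\<^sub>R i))\<^sup>2) has_real_derivative 2 * p x * - (frechet_derivative \<phi> (at x) i / \<delta>)) (at 0)"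
      by (simp add: p_def)
    from DERIV_diff[OF DERIV_const[of 1] this]
    have 1: "((\<lambda>t. 1 - (p (x + t *\<^sub>R i))\<^sup>2) has_real_derivative 2 * p x * (frechet_derivative \<phi> (at x) i / \<delta>)) (at 0)"
      by simp
    have 2: "((\<lambda>t. (x + t *\<^sub>R i) \<bullet> i) has_real_derivative 1) (at 0)"
      using i by (auto intro!: derivative_eq_intros simp: inner_add_left)
    show "((\<lambda>t. f (x + t *\<^sub>R i)) has_real_derivative f' x) (at 0)"
      unfolding f_def f'_def using DERIV_mult[OF 2 1] by (simp add: mult.commute)
  qed
  then have f'0: "(LINT x|lebesgue_on \<Omega>. f' x) = 0"
    using f0(2) K(2) by (subst integral_lebesgue_on_support(1)[OF \<Omega>(1)]) auto
  have f'i: "integrable (lebesgue_on \<Omega>) f'"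
  proof -
    obtain C where C: "\<And>x. \<bar>f' x\<bar> \<le> C"
      using continuous_compact_support_bounded[OF fc(2) K(1) f0(2)] by blast
    have "integrable lebesgue (\<lambda>x. 1 * f' x)"
      by (rule L1loc_mult_integrable[OF const_L1loc[of 1 UNIV] continuous_imp_lebesgue_measurable[OF fc(2)] C K(1)])
        (use f0 in auto)
    then show ?thesis
      using f0(2) K(2) by (subst integral_lebesgue_on_support(2)[OF \<Omega>(1)]) auto
  qed
  let ?h = "\<lambda>x. (1 / \<delta>\<^sup>2) * (w x - \<phi> x)\<^sup>2 + T * (\<kappa> * (norm (g x))\<^sup>2 + (1/\<kappa> + 1) * (w x - \<phi> x)\<^sup>2 + (norm (g x - grad \<phi> x))\<^sup>2)"
  have int: "integrable (lebesgue_on \<Omega>) (\<lambda>x. (w x - \<phi> x)\<^sup>2)"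
      "integrable (lebesgue_on \<Omega>) (\<lambda>x. (norm (g x))\<^sup>2)"
      "integrable (lebesgue_on \<Omega>) (\<lambda>x. (norm (g x - grad \<phi> x))\<^sup>2)"
    using L2_integrable_square[OF L2_add_cmult[OF wg(1) test_L2[OF \<Omega>(1) \<phi>], of "-1"]]
      L2_integrable_square[OF wg(2)]
      L2_integrable_square[OF L2_add_cmult[OF wg(2) grad_test_L2[OF \<Omega>(1) \<phi>], of "-1"]] by simp_all
  have "m = (LINT x|lebesgue_on \<Omega>. 1 - f' x)"
    using measure_lebesgue_bounded_open(1)[OF \<Omega>(1,2), of 1] measure_lebesgue_bounded_open(2)[OF \<Omega>(1,2), of 1] f'i f'0
    by (simp add: m_def)
  also have "\<dots> \<le> (LINT x|lebesgue_on \<Omega>. ?h x)"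
  proof (rule integral_mono)
    show "integrable (lebesgue_on \<Omega>) (\<lambda>x. 1 - f' x)"
      using measure_lebesgue_bounded_open(1)[OF \<Omega>(1,2), of 1] f'i by simp
    show "integrable (lebesgue_on \<Omega>) ?h" using int by simp
    fix x assume "x \<in> space (lebesgue_on \<Omega>)"
    then have x: "x \<in> \<Omega>" by simp
    let ?d = "frechet_derivative \<phi> (at x) i" and ?y = "\<bar>w x - \<phi> x\<bar>"
    have "1 - \<phi> x / \<delta> \<le> (w x - \<phi> x) / \<delta>"
      using \<delta>(2)[OF x] \<delta>(1) by (simp add: field_simps)
    also have "\<dots> \<le> ?y / \<delta>" using \<delta>(1) by (intro divide_right_mono) auto
    finally have p: "0 \<le> p x" "p x \<le> ?y / \<delta>" using \<delta>(1) by (auto simp: p_def)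
    have p2: "(p x)\<^sup>2 \<le> (1 / \<delta>\<^sup>2) * (w x - \<phi> x)\<^sup>2"
      using power_mono[OF p(2,1), of 2] by (simp add: power_divide)
    have d: "\<bar>?d\<bar> \<le> norm (g x) + norm (g x - grad \<phi> x)"
    proof -
      have "\<bar>?d\<bar> \<le> norm (grad \<phi> x)" using Basis_le_norm[OF i, of "grad \<phi> x"] by (simp add: grad_inner[OF i])
      also have "\<dots> \<le> norm (g x) + norm (g x - grad \<phi> x)"
        using norm_triangle_ineq4[of "g x" "g x - grad \<phi> x"] by simp
      finally show ?thesis .
    qed
    have xi: "\<bar>x \<bullet> i\<bar> \<le> R" using Basis_le_norm[OF i, of x] R(2)[OF x] by linarith
    have "- ((x \<bullet> i) * (2 * p x * (?d / \<delta>))) \<le> \<bar>x \<bullet> i\<bar> * (2 * p x * (\<bar>?d\<bar> / \<delta>))"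
    proof -
      have "- ((x \<bullet> i) * (2 * p x * (?d / \<delta>))) \<le> \<bar>(x \<bullet> i) * (2 * p x * (?d / \<delta>))\<bar>" by (rule abs_ge_minus_self)
      also have "\<dots> = \<bar>x \<bullet> i\<bar> * (2 * p x * (\<bar>?d\<bar> / \<delta>))" using p(1) \<delta>(1) by (simp add: abs_mult)
      finally show ?thesis .
    qed
    also have "\<dots> \<le> R * (2 * (?y / \<delta>) * (\<bar>?d\<bar> / \<delta>))"
      using xi p \<delta>(1) R(1) by (intro mult_mono) auto
    also have "\<dots> = T * (?y * \<bar>?d\<bar>)" by (simp add: T_def power2_eq_square)
    also have "\<dots> \<le> T * (\<kappa> * (norm (g x))\<^sup>2 + (1/\<kappa> + 1) * (w x - \<phi> x)\<^sup>2 + (norm (g x - grad \<phi> x))\<^sup>2)"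
    proof (rule mult_left_mono)
      have "?y * \<bar>?d\<bar> \<le> ?y * (norm (g x) + norm (g x - grad \<phi> x))"
        by (rule mult_left_mono[OF d]) simp
      also have "\<dots> = norm (g x) * ?y + norm (g x - grad \<phi> x) * ?y" by (simp add: algebra_simps)
      also have "\<dots> \<le> (\<kappa> * (norm (g x))\<^sup>2 + (1/\<kappa>) * ?y\<^sup>2) + (1 * (norm (g x - grad \<phi> x))\<^sup>2 + (1/1) * ?y\<^sup>2)"
        using Young_ineq[OF \<kappa>, of "norm (g x)" ?y] Young_ineq[OF zero_less_one, of "norm (g x - grad \<phi> x)" ?y]
        by linarith
      also have "\<dots> = \<kappa> * (norm (g x))\<^sup>2 + (1/\<kappa> + 1) * (w x - \<phi> x)\<^sup>2 + (norm (g x - grad \<phi> x))\<^sup>2"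
        by (simp add: distrib_right)
      finally show "?y * \<bar>?d\<bar> \<le> \<kappa> * (norm (g x))\<^sup>2 + (1/\<kappa> + 1) * (w x - \<phi> x)\<^sup>2 + (norm (g x - grad \<phi> x))\<^sup>2" .
    qed (use T in simp)
    finally show "1 - f' x \<le> ?h x" using p2 unfolding f'_def by linarith
  qed
  also have "\<dots> = (1 / \<delta>\<^sup>2) * N1 + T * (\<kappa> * I + (1/\<kappa> + 1) * N1 + N2)"
    using int by (simp add: N1_def N2_def I_def)
  also have "\<dots> = T * \<kappa> * I + (1 / \<delta>\<^sup>2 + T * (1/\<kappa> + 1)) * N1 + T * 1 * N2"
    by (simp add: algebra_simps)
  also have "\<dots> \<le> m / 4 + Q * N1 + Q * N2"
  proof -
    have "T * 1 \<le> T * (1/\<kappa> + 1)" using T \<kappa> by (intro mult_left_mono) auto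
    then have "T * 1 \<le> Q" unfolding Q_def using \<delta>(1) by (smt (verit) divide_nonneg_nonneg zero_le_power2)
    then have "T * 1 * N2 \<le> Q * N2" using N12(2) by (rule mult_right_mono)
    then show ?thesis using \<kappa>I by (simp add: Q_def)
  qed
  also have "\<dots> = m / 4 + Q * (N1 + N2)" by (simp add: distrib_left)
  also have "\<dots> < m / 4 + m / 2"
  proof -
    have "Q * (N1 + N2) < Q * (m / (2 * Q))"
      using N Q unfolding N1_def N2_def by (intro mult_strict_left_mono)
    then show ?thesis using Q by simp
  qed
  finally show False using m by simp
qed

section \<open>Truncation at the boundary supremum\<close>

lemma const_L2: "open \<Omega> \<Longrightarrow> bounded \<Omega> \<Longrightarrow> (\<lambda>x. c::real) \<in> L2 \<Omega>"
  using measure_lebesgue_bounded_open(1)[of \<Omega> "c\<^sup>2"] by (simp add: L2_def)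

lemma excess_has_weak_gradient:
  assumes "open \<Omega>" "bounded \<Omega>" "u \<in> L2 \<Omega>" "g \<in> L2 \<Omega>" "has_weak_gradient \<Omega> u g"
  shows "pos_part (\<lambda>x. u x - l) \<in> L2 \<Omega>"
    and "(\<lambda>x. if l < u x then g x else 0) \<in> L2 \<Omega>"
    and "has_weak_gradient \<Omega> (pos_part (\<lambda>x. u x - l)) (\<lambda>x. if l < u x then g x else 0)"
proof -
  have 1: "(\<lambda>x. u x - l) \<in> L2 \<Omega>"
    using L2_add_cmult[OF assms(3) const_L2[OF assms(1,2), of 1], of "-l"] by simp
  have 2: "has_weak_gradient \<Omega> (\<lambda>x. u x - l) g"
    using has_weak_gradient_add_cmult[OF assms(1,5) const_has_weak_gradient[OF assms(1), of 1], of "-l"] by simp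
  show "pos_part (\<lambda>x. u x - l) \<in> L2 \<Omega>" by (rule pos_part_L2[OF 1])
  show "(\<lambda>x. if l < u x then g x else 0) \<in> L2 \<Omega>"
    by (rule L2_restrict_superlevel[OF L2_measurable[OF assms(3)] assms(4)])
  show "has_weak_gradient \<Omega> (pos_part (\<lambda>x. u x - l)) (\<lambda>x. if l < u x then g x else 0)"
    using pos_part_has_weak_gradient[OF assms(1) 1 assms(4) 2] by simp
qed

text \<open>
  This makes the infimum in the boundary supremum a minimum when it is finite: \<open>(u - l)\<^sup>+\<close> depends
  on \<open>l\<close> continuously from the right in \<open>H\<^sup>1\<close>, and \<open>H10\<close> is closed.
\<close>
lemma excess_in_H10_limit:
  assumes \<Omega>: "open \<Omega>" "bounded \<Omega>" and u: "u \<in> L2 \<Omega>" "g \<in> L2 \<Omega>" "has_weak_gradient \<Omega> u g"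
    and l: "\<And>n::nat. r \<le> l n" "l \<longlonglongrightarrow> r" "\<And>n. pos_part (\<lambda>x. u x - l n) \<in> H10 \<Omega>"
  shows "pos_part (\<lambda>x. u x - r) \<in> H10 \<Omega>"
proof -
  note T = excess_has_weak_gradient[OF \<Omega> u]
  let ?T = "\<lambda>l. pos_part (\<lambda>x. u x - l)" and ?g = "\<lambda>l x. if l < u x then g x else 0"
  have ev: "\<forall>\<^sub>F n in sequentially. l n < u x" if "r < u x" for x
    using order_tendstoD(2)[OF l(2) that] .
  have 1: "(\<lambda>n. LINT x|lebesgue_on \<Omega>. (?T r x - ?T (l n) x)\<^sup>2) \<longlonglongrightarrow> (LINT x|lebesgue_on \<Omega>. 0)"
  proof (rule integral_dominated_convergence)
    show "integrable (lebesgue_on \<Omega>) (\<lambda>x. (?T r x)\<^sup>2)"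
      using L2_integrable_square[OF T(1)] by simp
    show "(\<lambda>x. (?T r x - ?T (l n) x)\<^sup>2) \<in> borel_measurable (lebesgue_on \<Omega>)" for n
      using L2_measurable[OF L2_diff[OF T(1) T(1)]] by simp
    show "AE x in lebesgue_on \<Omega>. (\<lambda>n. (?T r x - ?T (l n) x)\<^sup>2) \<longlonglongrightarrow> 0"
    proof (rule AE_I2)
      fix x
      have "(\<lambda>n. (max 0 (u x - r) - max 0 (u x - l n))\<^sup>2) \<longlonglongrightarrow> (max 0 (u x - r) - max 0 (u x - r))\<^sup>2"
        by (intro tendsto_intros l(2))
      then show "(\<lambda>n. (?T r x - ?T (l n) x)\<^sup>2) \<longlonglongrightarrow> 0" by (simp add: pos_part_def)
    qed
    show "AE x in lebesgue_on \<Omega>. norm ((?T r x - ?T (l n) x)\<^sup>2) \<le> (?T r x)\<^sup>2" for n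
    proof (rule AE_I2)
      fix x
      have "\<bar>?T r x - ?T (l n) x\<bar> \<le> \<bar>?T r x\<bar>" using l(1)[of n] by (auto simp: pos_part_def)
      then show "norm ((?T r x - ?T (l n) x)\<^sup>2) \<le> (?T r x)\<^sup>2" by (simp add: abs_le_square_iff)
    qed
  qed simp
  have 2: "(\<lambda>n. LINT x|lebesgue_on \<Omega>. (norm (?g r x - ?g (l n) x))\<^sup>2) \<longlonglongrightarrow> (LINT x|lebesgue_on \<Omega>. 0)"
  proof (rule integral_dominated_convergence)
    show "integrable (lebesgue_on \<Omega>) (\<lambda>x. (norm (g x))\<^sup>2)" by (rule L2_integrable_square[OF u(2)])
    show "(\<lambda>x. (norm (?g r x - ?g (l n) x))\<^sup>2) \<in> borel_measurable (lebesgue_on \<Omega>)" for n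
      by (rule borel_measurable_power,
          rule measurable_compose[OF L2_measurable[OF L2_diff[OF T(2)[of r] T(2)[of "l n"]]] borel_measurable_norm])
    show "AE x in lebesgue_on \<Omega>. (\<lambda>n. (norm (?g r x - ?g (l n) x))\<^sup>2) \<longlonglongrightarrow> 0"
    proof (rule AE_I2)
      fix x
      have "\<forall>\<^sub>F n in sequentially. ?g r x = ?g (l n) x"
      proof (cases "r < u x")
        case True
        show ?thesis using ev[OF True] by eventually_elim (use True in simp)
      next
        case False
        then have "\<not> l n < u x" for n using l(1)[of n] by linarith
        then show ?thesis using False by simp
      qed
      then have "\<forall>\<^sub>F n in sequentially. (norm (?g r x - ?g (l n) x))\<^sup>2 = 0"
        by eventually_elim simp
      then show "(\<lambda>n. (norm (?g r x - ?g (l n) x))\<^sup>2) \<longlonglongrightarrow> 0"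
        by (rule tendsto_eventually)
    qed
    show "AE x in lebesgue_on \<Omega>. norm ((norm (?g r x - ?g (l n) x))\<^sup>2) \<le> (norm (g x))\<^sup>2" for n
      by (rule AE_I2) auto
  qed simp
  show ?thesis
  proof (rule H10_closed[OF \<Omega>(1) T])
    fix \<epsilon> :: real assume "0 < \<epsilon>"
    then have "\<forall>\<^sub>F n in sequentially. (LINT x|lebesgue_on \<Omega>. (?T r x - ?T (l n) x)\<^sup>2) +
        (LINT x|lebesgue_on \<Omega>. (norm (?g r x - ?g (l n) x))\<^sup>2) < \<epsilon>"
      using order_tendstoD(2)[OF tendsto_add[OF 1 2], of \<epsilon>] by simp
    then obtain n where "(LINT x|lebesgue_on \<Omega>. (?T r x - ?T (l n) x)\<^sup>2) +
        (LINT x|lebesgue_on \<Omega>. (norm (?g r x - ?g (l n) x))\<^sup>2) < \<epsilon>"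
      using eventually_happens'[OF sequentially_bot] by blast
    then show "\<exists>w h. w \<in> H10 \<Omega> \<and> w \<in> L2 \<Omega> \<and> h \<in> L2 \<Omega> \<and> has_weak_gradient \<Omega> w h \<and>
      (LINT x|lebesgue_on \<Omega>. (?T r x - w x)\<^sup>2) + (LINT x|lebesgue_on \<Omega>. (norm (?g r x - h x))\<^sup>2) < \<epsilon>"
      using l(3)[of n] T[of "l n"] by blast
  qed
qed

lemma bdry_sup_cases:
  assumes \<Omega>: "open \<Omega>" "bounded \<Omega>" "\<Omega> \<noteq> {}" and U: "U \<in> H1 \<Omega>"
  obtains "bdry_sup \<Omega> (pos_part U) = \<infinity>"
  | r where "0 \<le> r" "bdry_sup \<Omega> (pos_part U) = ereal r" "pos_part (\<lambda>x. U x - r) \<in> H10 \<Omega>"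
proof -
  define S where "S = {ereal l | l. pos_part (\<lambda>x. pos_part U x - l) \<in> H10 \<Omega>}"
  have s: "bdry_sup \<Omega> (pos_part U) = Inf S" by (simp add: bdry_sup_def S_def)
  \<comment> \<open>For \<open>l < 0\<close> the function \<open>U\<^sup>+ - l\<close> is bounded below by \<open>-l > 0\<close>.\<close>
  have pos: "0 \<le> l" if "ereal l \<in> S" for l
  proof (rule ccontr)
    assume "\<not> 0 \<le> l"
    moreover have "pos_part (\<lambda>x. pos_part U x - l) \<in> H10 \<Omega>" using that by (simp add: S_def)
    ultimately show False
      by (intro H10_not_bounded_below[OF \<Omega>, of _ "-l"]) (auto simp: pos_part_def)
  qed
  have S_ereal: "\<exists>l. y = ereal l" if "y \<in> S" for y using that by (auto simp: S_def)
  have "0 \<le> Inf S"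
    using pos S_ereal by (intro Inf_greatest) fastforce
  then consider "Inf S = \<infinity>" | r where "Inf S = ereal r" "0 \<le> r"
    by (cases "Inf S") auto
  then show ?thesis
  proof cases
    case 1
    then show ?thesis using that(1) s by simp
  next
    case 2
    have "\<exists>l. ereal l \<in> S \<and> r \<le> l \<and> l < r + 1 / real (Suc n)" for n
    proof -
      have "Inf S < ereal (r + 1 / real (Suc n))" using 2 by simp
      then obtain y where y: "y \<in> S" "y < ereal (r + 1 / real (Suc n))" by (auto simp: Inf_less_iff)
      obtain k where k: "y = ereal k" using S_ereal[OF y(1)] by blast
      have "ereal r \<le> ereal k" using Inf_lower[OF y(1)] 2 k by simp
      then show ?thesis using y k by (intro exI[of _ k]) auto
    qed
    then obtain l where l: "\<And>n. ereal (l n) \<in> S" "\<And>n. r \<le> l n" "\<And>n. l n < r + 1 / real (Suc n)"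
      by metis
    have lim: "l \<longlonglongrightarrow> r"
    proof (rule tendsto_sandwich[OF _ _ tendsto_const])
      have "(\<lambda>n. r + 1 / real (Suc n)) \<longlonglongrightarrow> r + 0"
        by (intro tendsto_intros LIMSEQ_Suc[OF lim_1_over_n])
      then show "(\<lambda>n. r + 1 / real (Suc n)) \<longlonglongrightarrow> r" by simp
    qed (use l(2,3) in \<open>auto intro!: always_eventually intro: less_imp_le\<close>)
    have "pos_part (\<lambda>x. U x - l n) \<in> H10 \<Omega>" for n
    proof -
      have "0 \<le> l n" using l(2)[of n] 2 by linarith
      then have "pos_part (\<lambda>x. pos_part U x - l n) = pos_part (\<lambda>x. U x - l n)"
        by (auto simp: pos_part_def fun_eq_iff)
      then show ?thesis using l(1)[of n] by (simp add: S_def)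
    qed
    then have "pos_part (\<lambda>x. U x - r) \<in> H10 \<Omega>"
      by (rule excess_in_H10_limit[OF \<Omega>(1,2) H1_E[OF \<Omega>(1) U] l(2) lim])
    then show ?thesis using that(2) 2 s by simp
  qed
qed

lemma Linfty_mult_integrable:
  assumes "c \<in> Linfty \<Omega>" "integrable (lebesgue_on \<Omega>) f"
  shows "integrable (lebesgue_on \<Omega>) (\<lambda>x. c x * f x)"
proof -
  obtain C where C: "AE x in lebesgue_on \<Omega>. \<bar>c x\<bar> \<le> C" and cm: "c \<in> borel_measurable (lebesgue_on \<Omega>)"
    using assms(1) by (auto simp: Linfty_def)
  show ?thesis
  proof (rule Bochner_Integration.integrable_bound)
    show "integrable (lebesgue_on \<Omega>) (\<lambda>x. C * f x)" using assms(2) by simp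
    show "(\<lambda>x. c x * f x) \<in> borel_measurable (lebesgue_on \<Omega>)"
      using cm borel_measurable_integrable[OF assms(2)] by (rule borel_measurable_times)
    show "AE x in lebesgue_on \<Omega>. norm (c x * f x) \<le> norm (C * f x)"
      using C by eventually_elim (auto simp: abs_mult intro!: mult_right_mono)
  qed
qed

text \<open>
  Subtracting \<open>v = (U - r)\<^sup>+\<close> with \<open>r \<ge> 0\<close> does not increase the quadratic part of the functional,
  because the gradient of \<open>U - v\<close> vanishes where \<open>U > r\<close> and equals that of \<open>U\<close> elsewhere, and
  \<open>\<bar>U - v\<bar> \<le> \<bar>U\<bar>\<close>. The linear part changes by \<open>F(v) \<le> 0\<close>.
\<close>
lemma J_truncation_le:
  assumes \<Omega>: "open \<Omega>" "bounded \<Omega>" and c: "c \<in> Linfty \<Omega>" "AE x in lebesgue_on \<Omega>. 0 \<le> c x"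
    and u: "u \<in> H1 \<Omega>" and U: "U \<in> H1 \<Omega>" and r: "0 \<le> r"
    and F: "F_functional \<Omega> c u (pos_part (\<lambda>x. U x - r)) \<le> 0"
  shows "J_functional \<Omega> c u (\<lambda>x. U x - pos_part (\<lambda>x. U x - r) x) \<le> J_functional \<Omega> c u U"
    and "(\<lambda>x. U x - pos_part (\<lambda>x. U x - r) x) \<in> H1 \<Omega>"
proof -
  define v where "v = pos_part (\<lambda>x. U x - r)"
  define W where "W x = U x - v x" for x
  define G where "G = weak_gradient \<Omega> U"
  define a where "a = weak_gradient \<Omega> u"
  note GE = H1_E[OF \<Omega>(1) U, folded G_def] and aE = H1_E[OF \<Omega>(1) u, folded a_def]
  define gv where "gv x = (if r < U x then G x else 0)" for x
  have vE: "v \<in> L2 \<Omega>" "gv \<in> L2 \<Omega>" "has_weak_gradient \<Omega> v gv"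
    using excess_has_weak_gradient[OF \<Omega> GE, of r] by (auto simp: v_def gv_def[abs_def])
  have WE: "W \<in> L2 \<Omega>" "(\<lambda>x. G x - gv x) \<in> L2 \<Omega>" "has_weak_gradient \<Omega> W (\<lambda>x. G x - gv x)"
    using L2_add_cmult[OF GE(1) vE(1), of "-1"] L2_add_cmult[OF GE(2) vE(2), of "-1"]
      has_weak_gradient_add_cmult[OF \<Omega>(1) GE(3) vE(3), of "-1"] by (simp_all add: W_def[abs_def])
  have vH: "v \<in> H1 \<Omega>" and WH: "W \<in> H1 \<Omega>" using H1I[OF \<Omega>(1)] vE WE by auto
  then show "(\<lambda>x. U x - pos_part (\<lambda>x. U x - r) x) \<in> H1 \<Omega>" by (simp add: W_def[abs_def] v_def)
  have iF: "integrable (lebesgue_on \<Omega>) (\<lambda>x. a x \<bullet> weak_gradient \<Omega> z x + c x * u x * z x)"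
    and iQ: "integrable (lebesgue_on \<Omega>) (\<lambda>x. (norm (weak_gradient \<Omega> z x))\<^sup>2 + c x * \<bar>z x\<bar>\<^sup>2)"
    if z: "z \<in> H1 \<Omega>" for z
  proof -
    note zE = H1_E[OF \<Omega>(1) z]
    show "integrable (lebesgue_on \<Omega>) (\<lambda>x. a x \<bullet> weak_gradient \<Omega> z x + c x * u x * z x)"
      using L2_inner_integrable[OF aE(2) zE(2)] Linfty_mult_integrable[OF c(1) L2_mult_integrable[OF aE(1) zE(1)]]
      by (simp add: mult.assoc)
    show "integrable (lebesgue_on \<Omega>) (\<lambda>x. (norm (weak_gradient \<Omega> z x))\<^sup>2 + c x * \<bar>z x\<bar>\<^sup>2)"
      using L2_integrable_square[OF zE(2)] Linfty_mult_integrable[OF c(1) L2_integrable_square[OF zE(1)]]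
      by simp
  qed
  let ?F = "\<lambda>z x. a x \<bullet> weak_gradient \<Omega> z x + c x * u x * z x"
  let ?Q = "\<lambda>z x. (norm (weak_gradient \<Omega> z x))\<^sup>2 + c x * \<bar>z x\<bar>\<^sup>2"
  have "0 \<le> (LINT x|lebesgue_on \<Omega>. 1/2 * (?Q U x - ?Q W x) - (?F U x - ?F W x - ?F v x))"
  proof (rule integral_nonneg_AE)
    show "AE x in lebesgue_on \<Omega>. 0 \<le> 1/2 * (?Q U x - ?Q W x) - (?F U x - ?F W x - ?F v x)"
      using weak_gradient_AE_eq[OF \<Omega>(1) vE(3)] weak_gradient_AE_eq[OF \<Omega>(1) WE(3)] c(2)
    proof eventually_elim
      case (elim x)
      have F0: "?F U x - ?F W x - ?F v x = 0"
        unfolding elim(1,2) G_def[symmetric] by (simp add: W_def inner_diff_right algebra_simps)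
      have "(norm (G x - gv x))\<^sup>2 \<le> (norm (G x))\<^sup>2" by (simp add: gv_def)
      moreover have "c x * \<bar>W x\<bar>\<^sup>2 \<le> c x * \<bar>U x\<bar>\<^sup>2"
      proof (rule mult_left_mono[OF _ elim(3)])
        have "\<bar>W x\<bar> \<le> \<bar>U x\<bar>" using r by (auto simp: W_def v_def pos_part_def)
        then show "\<bar>W x\<bar>\<^sup>2 \<le> \<bar>U x\<bar>\<^sup>2" by (rule power_mono) simp
      qed
      ultimately have "?Q W x \<le> ?Q U x"
        unfolding elim(2) G_def[symmetric] by linarith
      then show ?case using F0 by simp
    qed
  qed
  also have "\<dots> = 1/2 * ((LINT x|lebesgue_on \<Omega>. ?Q U x) - (LINT x|lebesgue_on \<Omega>. ?Q W x))
      - ((LINT x|lebesgue_on \<Omega>. ?F U x) - (LINT x|lebesgue_on \<Omega>. ?F W x) - (LINT x|lebesgue_on \<Omega>. ?F v x))"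
    by (simp only: Bochner_Integration.integral_diff integral_mult_right_zero
        Bochner_Integration.integrable_diff integrable_mult_right iF[OF U] iF[OF WH] iF[OF vH] iQ[OF U] iQ[OF WH])
  finally have "J_functional \<Omega> c u W \<le> J_functional \<Omega> c u U + F_functional \<Omega> c u v"
    by (simp add: J_functional_def F_functional_def a_def algebra_simps)
  then have "J_functional \<Omega> c u W \<le> J_functional \<Omega> c u U" using F by (simp add: v_def)
  then show "J_functional \<Omega> c u (\<lambda>x. U x - pos_part (\<lambda>x. U x - r) x) \<le> J_functional \<Omega> c u U"
    by (simp add: W_def[abs_def] v_def)
qed

theorem theorem2p1:
  fixes \<Omega> :: "'a::euclidean_space set"
    and c u U :: "'a \<Rightarrow> real"
  assumes "open \<Omega>" and "connected \<Omega>" and "\<Omega> \<noteq> {}" and "bounded \<Omega>"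
    and "c \<in> Linfty \<Omega>" and "AE x in lebesgue_on \<Omega>. 0 \<le> c x"
    and "u \<in> H1 \<Omega>"
    and "\<And>v. v \<in> H10 \<Omega> \<Longrightarrow> (AE x in lebesgue_on \<Omega>. 0 \<le> v x) \<Longrightarrow> F_functional \<Omega> c u v \<le> 0"
    and "U \<in> H1 \<Omega>"
  shows "U_star \<Omega> U \<in> H1 \<Omega> \<and>
         J_functional \<Omega> c u (U_star \<Omega> U) \<le> J_functional \<Omega> c u U \<and>
         (\<lambda>x. U_star \<Omega> U x - U x) \<in> H10 \<Omega>"
proof (rule bdry_sup_cases[OF assms(1,4,3,9)])
  assume "bdry_sup \<Omega> (pos_part U) = \<infinity>"
  then have "U_star \<Omega> U = U" by (simp add: U_star_def fun_eq_iff)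
  then show ?thesis using zero_in_H10[OF assms(1)] assms(9) by simp
next
  fix r assume r: "0 \<le> r" "bdry_sup \<Omega> (pos_part U) = ereal r" "pos_part (\<lambda>x. U x - r) \<in> H10 \<Omega>"
  have U: "U_star \<Omega> U = (\<lambda>x. U x - pos_part (\<lambda>x. U x - r) x)"
    unfolding U_star_def r(2) by (auto simp: pos_part_def min_def max_def)
  have "F_functional \<Omega> c u (pos_part (\<lambda>x. U x - r)) \<le> 0"
    by (rule assms(8)[OF r(3)]) (simp add: pos_part_def)
  then show ?thesis
    unfolding U using J_truncation_le[OF assms(1,4,5,6,7,9) r(1)] H10_uminus[OF assms(1) r(3)] by simp
qed

end
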